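(* Let $I=(F_1,\ldots,F_r)\subseteq R=k[x_0,\ldots,x_n]$ be a homogeneous complete intersection of type $(d_1,\ldots,d_r)$, and let $s\geq 1$ be an integer. Then for all $i$, \[ H_{R/I^s}(i) = \sum_{(a_1,\ldots,a_r) \in \mathcal{L}_{r,s}} H_{R/I}(i-a_1d_1-\cdots-a_rd_r). \]
   Context: $k$ is an infinite field of characteristic $0$ and $R=k[x_0,\ldots,x_n]$ has the standard grading. A homogeneous ideal $I=(F_1,\ldots,F_r)\subseteq R$ is a complete intersection of type $(d_1,\ldots,d_r)$ if $F_1,\ldots,F_r$ is a regular sequence on $R$ of homogeneous forms with $\deg F_i=d_i$; the forms are ordered so that $d_1\leq\cdots\leq d_r$. For a homogeneous ideal $J\subseteq R$, the Hilbert function of $R/J$ is $H_{R/J}(i):=\dim_k (R/J)_i$, which is $0$ for $i<0$. With $\mathbb{N}$ the set of non-negative integers, \[ \mathcal{L}_{r,s} := \{(a_1,\ldots,a_r)\in\mathbb{N}^r \mid a_1+\cdots+a_r\leq s-1\}. \] *)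

theory Defs
  imports "HOL-Algebra.Algebra" "HOL-Library.Poly_Mapping"
begin

text \<open>
  A monomial is its exponent map \<open>nat \<Rightarrow>\<^sub>0 nat\<close>, and a polynomial maps finitely many monomials
  to non-zero coefficients. The ring \<open>k[x\<^sub>0, ..., x\<^sub>n]\<close> is obtained by allowing only the
  variables \<open>0, ..., n\<close>; the field \<open>k\<close> is the type of coefficients.
\<close>

type_synonym 'k mpol = "(nat \<Rightarrow>\<^sub>0 nat) \<Rightarrow>\<^sub>0 'k"

definition mpol_ring :: "nat \<Rightarrow> 'k::field mpol ring" where
  "mpol_ring n =
     \<lparr>carrier = {p. \<forall>m \<in> Poly_Mapping.keys p. Poly_Mapping.keys m \<subseteq> {0..n}},
      monoid.mult = (*), one = 1, ring.zero = 0, add = (+)\<rparr>"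

definition total_degree :: "(nat \<Rightarrow>\<^sub>0 nat) \<Rightarrow> nat" where
  "total_degree m = (\<Sum>j \<in> Poly_Mapping.keys m. Poly_Mapping.lookup m j)"

text \<open>The graded piece of degree \<open>d\<close>; it contains the zero polynomial for every \<open>d\<close>.\<close>

definition forms :: "nat \<Rightarrow> nat \<Rightarrow> 'k::field mpol set" where
  "forms n d = {p \<in> carrier (mpol_ring n). \<forall>m \<in> Poly_Mapping.keys p. total_degree m = d}"

definition nonzerodivisor :: "('a, 'b) ring_scheme \<Rightarrow> 'a \<Rightarrow> bool" where
  "nonzerodivisor R a \<longleftrightarrow>
     a \<in> carrier R \<and> (\<forall>x \<in> carrier R. a \<otimes>\<^bsub>R\<^esub> x = \<zero>\<^bsub>R\<^esub> \<longrightarrow> x = \<zero>\<^bsub>R\<^esub>)"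

definition regular_sequence :: "('a, 'b) ring_scheme \<Rightarrow> 'a list \<Rightarrow> bool" where
  "regular_sequence R Fs \<longleftrightarrow>
     set Fs \<subseteq> carrier R \<and>
     (\<forall>j < length Fs.
        nonzerodivisor (R Quot Idl\<^bsub>R\<^esub> (set (take j Fs)))
          (Idl\<^bsub>R\<^esub> (set (take j Fs)) +>\<^bsub>R\<^esub> Fs ! j)) \<and>
     Idl\<^bsub>R\<^esub> (set Fs) \<noteq> carrier R"

text \<open>
  Regularity forces every form of the sequence to be non-zero, so that membership in
  \<open>forms n d\<close> says that its degree is exactly \<open>d\<close>.
\<close>

definition complete_intersection :: "nat \<Rightarrow> nat list \<Rightarrow> 'k::field mpol list \<Rightarrow> bool" where
  "complete_intersection n ds Fs \<longleftrightarrow>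
     length ds = length Fs \<and> sorted ds \<and>
     (\<forall>j < length Fs. Fs ! j \<in> forms n (ds ! j)) \<and>
     regular_sequence (mpol_ring n) Fs"

text \<open>
  For a homogeneous ideal \<open>J\<close>, the piece of degree \<open>d\<close> of the quotient ring consists of the cosets
  of the forms of degree \<open>d\<close>. It is a vector space over the image of \<open>k\<close> in the quotient; if \<open>J\<close>
  is the whole ring, that image is trivial and the dimension is still the expected \<open>0\<close>.
\<close>

definition scalars_mod :: "nat \<Rightarrow> 'k::field mpol set \<Rightarrow> 'k mpol set set" where
  "scalars_mod n J = (\<lambda>c. J +>\<^bsub>mpol_ring n\<^esub> Poly_Mapping.single 0 c) ` UNIV"

definition forms_mod :: "nat \<Rightarrow> 'k::field mpol set \<Rightarrow> nat \<Rightarrow> 'k mpol set set" where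
  "forms_mod n J d = (\<lambda>p. J +>\<^bsub>mpol_ring n\<^esub> p) ` forms n d"

definition hilbert_function :: "nat \<Rightarrow> 'k::field mpol set \<Rightarrow> int \<Rightarrow> nat" where
  "hilbert_function n J i =
     (if i < 0 then 0
      else (ring.dim (mpol_ring n Quot J) over scalars_mod n J) (forms_mod n J (nat i)))"

definition exponents :: "nat \<Rightarrow> nat \<Rightarrow> nat list set" where
  "exponents r s = {as. length as = r \<and> int (sum_list as) \<le> int s - 1}"

end

theory Submission
  imports Defs
begin

text \<open>
  Let \<open>I = J + (F)\<close>, where \<open>J\<close> is generated by all forms of the sequence but the last one, \<open>F\<close>,
  of degree \<open>d\<close>. The form \<open>F\<close> is a nonzerodivisor modulo \<open>J\<close>, hence modulo every power of \<open>J\<close>. Since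
  \<open>I\<^sup>s\<^sup>+\<^sup>1 = J\<^sup>s\<^sup>+\<^sup>1 + F I\<^sup>s\<close>, it follows that \<open>I\<^sup>s\<^sup>+\<^sup>1 : F = I\<^sup>s\<close>, and
  \<open>I\<^sup>s\<^sup>+\<^sup>1 + (F) = J\<^sup>s\<^sup>+\<^sup>1 + (F)\<close>. Multiplication by \<open>F\<close> therefore gives, with
  \<open>C\<^sub>s = J\<^sup>s + (F)\<close>, the two recursions
  \<open>H(R/J\<^sup>s, i) = H(R/J\<^sup>s, i - d) + H(R/C\<^sub>s, i)\<close> and
  \<open>H(R/I\<^sup>s\<^sup>+\<^sup>1, i) = H(R/I\<^sup>s, i - d) + H(R/C\<^sub>s\<^sub>+\<^sub>1, i)\<close>.
  Inductively the first one expresses \<open>H(R/C\<^sub>s)\<close> by the exponents whose last entry is \<open>0\<close>, and the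
  second one adds the exponents whose last entry is positive.
\<close>

no_notation Sum_Type.Plus (infixr "<+>" 65)

section \<open>Powers of ideals and regular elements\<close>

text \<open>Regularity on R/K is expressed by elements, so that no quotient ring has to be formed.
  \<open>K\<close> may be the whole ring, where every ring element qualifies; this starts inductions
  at the power 0.\<close>

definition nzd_mod :: "('a, 'b) ring_scheme \<Rightarrow> 'a set \<Rightarrow> 'a \<Rightarrow> bool" where
  "nzd_mod R K x \<longleftrightarrow> x \<in> carrier R \<and> (\<forall>y \<in> carrier R. x \<otimes>\<^bsub>R\<^esub> y \<in> K \<longrightarrow> y \<in> K)"

lemma nzd_modD:
  assumes "nzd_mod R K x" "x \<otimes>\<^bsub>R\<^esub> y \<in> K" "y \<in> carrier R" shows "y \<in> K"
  using assms by (simp add: nzd_mod_def)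

definition ideal_pow :: "('a, 'b) ring_scheme \<Rightarrow> 'a set \<Rightarrow> nat \<Rightarrow> 'a set" (infixr "\<up>\<index>" 85) where
  "J \<up>\<^bsub>R\<^esub> t = J [^]\<^bsub>ideals_set R\<^esub> t"

context cring
begin

text \<open>
  For \<open>K = J\<close> and a regular element \<open>x\<close> modulo \<open>J\<close>, this propagates regularity from \<open>J\<^sup>t\<close> to \<open>J\<^sup>t\<^sup>+\<^sup>1\<close>.
  Arbitrary \<open>K \<supseteq> J\<close> make the property inductive: extending \<open>J\<close> to \<open>J + (G)\<close> only uses it for \<open>J\<close>
  with ideals \<open>K\<close> that contain \<open>G\<close>.
\<close>

definition nzd_lifts :: "'a set \<Rightarrow> bool" where
  "nzd_lifts J \<longleftrightarrow>
     (\<forall>K x. \<forall>t :: nat. \<forall>a \<in> J \<up> t.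
        ideal K R \<longrightarrow> J \<subseteq> K \<longrightarrow> nzd_mod R K x \<longrightarrow> x \<otimes> a \<in> K \<cdot> J \<up> t \<longrightarrow> a \<in> K \<cdot> J \<up> t)"

lemma nzd_liftsD:
  assumes "nzd_lifts J" "ideal K R" "J \<subseteq> K" "nzd_mod R K x" "a \<in> J \<up> t" "x \<otimes> a \<in> K \<cdot> J \<up> t"
  shows "a \<in> K \<cdot> J \<up> t"
  using assms unfolding nzd_lifts_def by blast

section \<open>Powers of ideals and sums with a principal ideal\<close>

lemma ideal_pow_0 [simp]: "J \<up> 0 = carrier R"
  by (simp add: ideal_pow_def ideals_set_def)

lemma ideal_pow_Suc: "J \<up> Suc t = J \<up> t \<cdot> J"
  by (simp add: ideal_pow_def ideals_set_def nat_pow_def)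

lemma ideal_pow_ideal:
  assumes "ideal J R" shows "ideal (J \<up> t) R"
proof (induction t)
  case (Suc t)
  then show ?case unfolding ideal_pow_Suc by (intro ideal_prod_is_ideal assms)
qed (unfold ideal_pow_0, rule oneideal)

lemma ideal_pow_Suc':
  assumes "ideal J R" shows "J \<up> Suc t = J \<cdot> J \<up> t"
  unfolding ideal_pow_Suc by (intro ideal_prod_commute ideal_pow_ideal assms)

lemma ideal_pow_1:
  assumes "ideal J R" shows "J \<up> Suc 0 = J"
  unfolding ideal_pow_Suc'[OF assms] ideal_pow_0 by (rule ideal_prod_one[OF assms])

lemma ideal_prod_mono:
  assumes "I \<subseteq> I'" "J \<subseteq> J'" shows "I \<cdot> J \<subseteq> I' \<cdot> J'"
proof
  fix x assume "x \<in> I \<cdot> J"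
  then show "x \<in> I' \<cdot> J'"
    by induction (use assms in \<open>auto intro: ideal_prod.intros\<close>)
qed

lemma ideal_pow_mono:
  assumes "I \<subseteq> J" shows "I \<up> t \<subseteq> J \<up> t"
proof (induction t)
  case (Suc t)
  then show ?case unfolding ideal_pow_Suc by (intro ideal_prod_mono assms)
qed simp

lemma ideal_pow_Suc_subset:
  assumes "ideal J R" shows "J \<up> Suc t \<subseteq> J \<up> t" "J \<up> Suc t \<subseteq> J"
  unfolding ideal_pow_Suc using ideal_prod_inter[OF ideal_pow_ideal[OF assms] assms] by blast+

lemma zero_pow_Suc: "{\<zero>} \<up> Suc t = {\<zero>}"
  unfolding ideal_pow_Suc by (intro ideal_prod_zero ideal_pow_ideal zeroideal)

lemma mem_add_PIdl_iff:
  assumes "ideal J R" "G \<in> carrier R"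
  shows "x \<in> J <+> PIdl G \<longleftrightarrow> (\<exists>j \<in> J. \<exists>r \<in> carrier R. x = j \<oplus> G \<otimes> r)"
  using assms by (auto simp: set_add_def' cgenideal_def m_comm)

lemma ideal_add_PIdl:
  assumes "ideal J R" "G \<in> carrier R"
  shows "ideal (J <+> PIdl G) R" "J \<subseteq> J <+> PIdl G" "G \<in> J <+> PIdl G"
proof -
  interpret J: ideal J R by fact
  show "ideal (J <+> PIdl G) R"
    by (intro add_ideals assms cgenideal_ideal)
  show "J \<subseteq> J <+> PIdl G"
  proof
    fix x assume "x \<in> J"
    moreover from this have "x = x \<oplus> G \<otimes> \<zero>" using assms J.Icarr by simp
    ultimately show "x \<in> J <+> PIdl G"
      unfolding mem_add_PIdl_iff[OF assms] using zero_closed by blast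
  qed
  have "G = \<zero> \<oplus> G \<otimes> \<one>" using assms by simp
  then show "G \<in> J <+> PIdl G"
    unfolding mem_add_PIdl_iff[OF assms] using one_closed J.zero_closed by blast
qed

lemma Idl_insert:
  assumes "S \<subseteq> carrier R" "G \<in> carrier R"
  shows "Idl (insert G S) = Idl S <+> PIdl G"
proof
  note 1 = ideal_add_PIdl[OF genideal_ideal[OF assms(1)] assms(2)]
  show "Idl (insert G S) \<subseteq> Idl S <+> PIdl G"
    by (intro genideal_minimal 1) (use 1 genideal_self[OF assms(1)] in auto)
  have i: "ideal (Idl (insert G S)) R" "insert G S \<subseteq> Idl (insert G S)"
    using assms genideal_ideal[of "insert G S"] genideal_self[of "insert G S"] by auto
  then interpret I: ideal "Idl (insert G S)" R by simp
  have "Idl S \<subseteq> Idl (insert G S)" using i by (intro genideal_minimal) auto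
  then show "Idl S <+> PIdl G \<subseteq> Idl (insert G S)"
    using i assms by (auto simp: mem_add_PIdl_iff genideal_ideal intro!: I.a_closed I.I_r_closed)
qed

text \<open>This is the inclusion of I^(t+1) in J^(t+1) + G I^t for I = J + (G). In the induction a
  generator of I^(t+2) is a product (a + G b)(c + G r), and all of it except a c is G times an
  element of I^(t+1).\<close>

lemma ideal_pow_Suc_split:
  assumes "ideal J R" "G \<in> carrier R" "x \<in> (J <+> PIdl G) \<up> Suc t"
  obtains a b where "a \<in> J \<up> Suc t" "b \<in> (J <+> PIdl G) \<up> t" "x = a \<oplus> G \<otimes> b"
proof -
  let ?I = "J <+> PIdl G"
  note I = ideal_add_PIdl[OF assms(1,2)]
  have Jt: "ideal (J \<up> t) R" and It: "ideal (?I \<up> t) R" for t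
    using I assms by (auto intro!: ideal_pow_ideal)
  interpret J: ideal J R by fact
  interpret I: ideal ?I R by fact
  have "\<exists>a \<in> J \<up> Suc t. \<exists>b \<in> ?I \<up> t. x = a \<oplus> G \<otimes> b"
    using assms(3)
  proof (induction t arbitrary: x)
    case 0
    then show ?case
      unfolding ideal_pow_1[OF I(1)] ideal_pow_1[OF assms(1)] ideal_pow_0 mem_add_PIdl_iff[OF assms(1,2)] .
  next
    case (Suc t)
    interpret Jt: ideal "J \<up> Suc (Suc t)" R by (rule Jt)
    interpret Jt': ideal "J \<up> Suc t" R by (rule Jt)
    interpret It: ideal "?I \<up> Suc t" R by (rule It)
    interpret It': ideal "?I \<up> t" R by (rule It)
    from Suc.prems have "x \<in> ?I \<up> Suc t \<cdot> ?I" by (simp only: ideal_pow_Suc)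
    then show ?case
    proof induction
      case (prod i j)
      obtain a b where ab: "a \<in> J \<up> Suc t" "b \<in> ?I \<up> t" "i = a \<oplus> G \<otimes> b" using Suc.IH[OF prod(1)] by blast
      obtain c r where cr: "c \<in> J" "r \<in> carrier R" "j = c \<oplus> G \<otimes> r"
        using prod(2) by (auto simp: mem_add_PIdl_iff assms)
      have carr: "a \<in> carrier R" "b \<in> carrier R" "c \<in> carrier R"
        using ab cr Jt'.Icarr It'.Icarr J.Icarr by auto
      have "a \<otimes> c \<in> J \<up> Suc (Suc t)"
        unfolding ideal_pow_Suc[of J "Suc t"] using ab cr by (intro ideal_prod.prod)
      moreover have "b \<otimes> j \<in> ?I \<up> Suc t"
        unfolding ideal_pow_Suc[of ?I t] using ab prod by (intro ideal_prod.prod)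
      moreover have "a \<otimes> r \<in> ?I \<up> Suc t"
        using ab cr ideal_pow_mono[OF I(2)] by (intro It.I_r_closed) auto
      \<comment> \<open>Only the copy of \<open>j\<close> next to \<open>a\<close> is expanded;
        leaving \<open>j\<close> intact next to \<open>b\<close> is what raises \<open>b\<close>
        from I^t to I^(t+1).\<close>
      moreover have "i \<otimes> j = a \<otimes> c \<oplus> G \<otimes> (b \<otimes> j \<oplus> a \<otimes> r)"
        unfolding ab cr using carr cr assms(2) by algebra
      ultimately show ?case using It.a_closed by blast
    next
      case (sum x y)
      then obtain a b a' b' where ab: "a \<in> J \<up> Suc (Suc t)" "b \<in> ?I \<up> Suc t" "x = a \<oplus> G \<otimes> b"
          "a' \<in> J \<up> Suc (Suc t)" "b' \<in> ?I \<up> Suc t" "y = a' \<oplus> G \<otimes> b'" by blast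
      then have carr: "a \<in> carrier R" "b \<in> carrier R" "a' \<in> carrier R" "b' \<in> carrier R"
        using Jt.Icarr It.Icarr by auto
      have "x \<oplus> y = (a \<oplus> a') \<oplus> G \<otimes> (b \<oplus> b')"
        unfolding ab using carr assms(2) by algebra
      then show ?case using ab Jt.a_closed It.a_closed by blast
    qed
  qed
  then show ?thesis using that by blast
qed

text \<open>The preceding splitting multiplied by K: k (a + G b) = k a + G (k b), and sums of such
  elements keep this shape.\<close>

lemma ideal_prod_pow_Suc_split:
  assumes "ideal J R" "G \<in> carrier R" "ideal K R" "x \<in> K \<cdot> (J <+> PIdl G) \<up> Suc t"
  obtains a b where "a \<in> K \<cdot> J \<up> Suc t" "b \<in> K \<cdot> (J <+> PIdl G) \<up> t" "x = a \<oplus> G \<otimes> b"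
proof -
  let ?I = "J <+> PIdl G"
  note I = ideal_add_PIdl[OF assms(1,2)]
  interpret K: ideal K R by fact
  interpret Jt: ideal "J \<up> Suc t" R by (intro ideal_pow_ideal assms)
  interpret It: ideal "?I \<up> t" R by (intro ideal_pow_ideal I)
  interpret KJt: ideal "K \<cdot> J \<up> Suc t" R by (intro ideal_prod_is_ideal Jt.is_ideal assms)
  interpret KIt: ideal "K \<cdot> ?I \<up> t" R by (intro ideal_prod_is_ideal It.is_ideal assms)
  have "\<exists>a \<in> K \<cdot> J \<up> Suc t. \<exists>b \<in> K \<cdot> ?I \<up> t. x = a \<oplus> G \<otimes> b"
    using assms(4)
  proof induction
    case (prod k j)
    obtain a b where ab: "a \<in> J \<up> Suc t" "b \<in> ?I \<up> t" "j = a \<oplus> G \<otimes> b"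
      using ideal_pow_Suc_split[OF assms(1,2) prod(2)] by blast
    have carr: "k \<in> carrier R" "a \<in> carrier R" "b \<in> carrier R"
      using ab prod Jt.Icarr It.Icarr K.Icarr by auto
    have "k \<otimes> j = k \<otimes> a \<oplus> G \<otimes> (k \<otimes> b)"
      unfolding ab(3) using carr assms(2) by (simp add: r_distr m_lcomm)
    moreover have "k \<otimes> a \<in> K \<cdot> J \<up> Suc t" "k \<otimes> b \<in> K \<cdot> ?I \<up> t"
      using ab prod by (auto intro: ideal_prod.prod)
    ultimately show ?case by blast
  next
    case (sum x y)
    then obtain a b a' b' where ab: "a \<in> K \<cdot> J \<up> Suc t" "b \<in> K \<cdot> ?I \<up> t" "x = a \<oplus> G \<otimes> b"
        "a' \<in> K \<cdot> J \<up> Suc t" "b' \<in> K \<cdot> ?I \<up> t" "y = a' \<oplus> G \<otimes> b'" by blast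
    then have carr: "a \<in> carrier R" "b \<in> carrier R" "a' \<in> carrier R" "b' \<in> carrier R"
      using KJt.Icarr KIt.Icarr by auto
    have "x \<oplus> y = (a \<oplus> a') \<oplus> G \<otimes> (b \<oplus> b')"
      unfolding ab using carr assms(2) by algebra
    then show ?case using ab KJt.a_closed KIt.a_closed by blast
  qed
  then show ?thesis using that by blast
qed

text \<open>If x y lies in J^(t+1), it lies in J^t, so y is in J^t by induction. The lifting
  property with K = J then improves this to J J^t = J^(t+1).\<close>

lemma nzd_mod_pow:
  assumes "nzd_lifts J" "ideal J R" "nzd_mod R J x"
  shows "nzd_mod R (J \<up> t) x"
proof (induction t)
  case (Suc t)
  have "y \<in> J \<up> Suc t" if y: "y \<in> carrier R" "x \<otimes> y \<in> J \<up> Suc t" for y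
  proof -
    have "x \<otimes> y \<in> J \<up> t" using y ideal_pow_Suc_subset[OF assms(2)] by blast
    then have "y \<in> J \<up> t" by (rule nzd_modD[OF Suc _ y(1)])
    then show ?thesis
      using nzd_liftsD[OF assms(1,2) _ assms(3)] y unfolding ideal_pow_Suc'[OF assms(2)] by blast
  qed
  then show ?case using assms(3) unfolding nzd_mod_def by blast
qed (use assms(3) in \<open>simp add: nzd_mod_def\<close>)

text \<open>For t = 0 the ideal K J^0 is K, and the claim is the regularity of x modulo K. For t > 0
  the only possible \<open>a\<close> is 0.\<close>

lemma nzd_lifts_zero: "nzd_lifts {\<zero>}"
  unfolding nzd_lifts_def
proof (intro allI ballI impI)
  fix K x t a
  assume a: "a \<in> {\<zero>} \<up> t" and K: "ideal K R" and x: "nzd_mod R K x" "x \<otimes> a \<in> K \<cdot> {\<zero>} \<up> t"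
  show "a \<in> K \<cdot> {\<zero>} \<up> t"
  proof (cases t)
    case 0
    then show ?thesis using a x ideal_prod_one[OF K] unfolding nzd_mod_def by simp
  next
    case (Suc m)
    then show ?thesis
      using a ideal_prod_zero[OF K] unfolding Suc zero_pow_Suc by simp
  qed
qed

text \<open>The induction on t writes a = a' + G b and x a = p + G q. Regularity of G modulo J^(t+1)
  controls q - x b, which lets the induction hypothesis place b in K I^t. The hypothesis on J, used
  with the larger ideal K, then places a' in K J^(t+1).\<close>

lemma nzd_lifts_step:
  assumes "nzd_lifts J" "ideal J R" "nzd_mod R J G"
  shows "nzd_lifts (J <+> PIdl G)"
proof -
  let ?I = "J <+> PIdl G"
  have G: "G \<in> carrier R" using assms(3) by (simp add: nzd_mod_def)
  note I = ideal_add_PIdl[OF assms(2) G]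
  have lift: "a \<in> K \<cdot> ?I \<up> t"
    if K: "ideal K R" "?I \<subseteq> K" and x: "nzd_mod R K x" and a: "a \<in> ?I \<up> t" "x \<otimes> a \<in> K \<cdot> ?I \<up> t" for K x t a
    using a
  proof (induction t arbitrary: a)
    case 0
    then show ?case using x ideal_prod_one[OF K(1)] unfolding nzd_mod_def by simp
  next
    case (Suc t)
    interpret K: ideal K R by fact
    interpret Jt: ideal "J \<up> Suc t" R by (intro ideal_pow_ideal assms)
    interpret It: ideal "?I \<up> t" R by (intro ideal_pow_ideal I)
    interpret KJt: ideal "K \<cdot> J \<up> Suc t" R by (intro ideal_prod_is_ideal Jt.is_ideal K)
    interpret KIt: ideal "K \<cdot> ?I \<up> t" R by (intro ideal_prod_is_ideal It.is_ideal K)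
    interpret KIt': ideal "K \<cdot> ?I \<up> Suc t" R by (intro ideal_prod_is_ideal ideal_pow_ideal I K)
    have xc: "x \<in> carrier R" using x by (simp add: nzd_mod_def)
    obtain a' b where ab: "a' \<in> J \<up> Suc t" "b \<in> ?I \<up> t" "a = a' \<oplus> G \<otimes> b"
      using ideal_pow_Suc_split[OF assms(2) G Suc.prems(1)] .
    obtain p q where pq: "p \<in> K \<cdot> J \<up> Suc t" "q \<in> K \<cdot> ?I \<up> t" "x \<otimes> a = p \<oplus> G \<otimes> q"
      using ideal_prod_pow_Suc_split[OF assms(2) G K(1) Suc.prems(2)] .
    have carr: "a' \<in> carrier R" "b \<in> carrier R" "p \<in> carrier R" "q \<in> carrier R"
      using ab pq Jt.Icarr It.Icarr KJt.Icarr KIt.Icarr by auto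
    have eq: "x \<otimes> a' = p \<oplus> G \<otimes> (q \<ominus> x \<otimes> b)"
    proof -
      have "x \<otimes> a' = x \<otimes> (a' \<oplus> G \<otimes> b) \<ominus> x \<otimes> (G \<otimes> b)" using carr xc G by algebra
      also have "\<dots> = (p \<oplus> G \<otimes> q) \<ominus> x \<otimes> (G \<otimes> b)" by (simp only: pq(3)[symmetric] ab(3)[symmetric])
      also have "\<dots> = p \<oplus> G \<otimes> (q \<ominus> x \<otimes> b)" using carr xc G by algebra
      finally show ?thesis .
    qed
    \<comment> \<open>Both x a' and p lie in J^(t+1), hence so does G (q - x b), and the factor G
      can be cancelled modulo this power.\<close>
    have "G \<otimes> (q \<ominus> x \<otimes> b) = x \<otimes> a' \<ominus> p" unfolding eq using carr xc G by algebra
    moreover have "p \<in> J \<up> Suc t"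
      using pq(1) ideal_prod_inter[OF K(1) Jt.is_ideal] by blast
    then have "x \<otimes> a' \<ominus> p \<in> J \<up> Suc t"
      unfolding a_minus_def using ab xc by (intro Jt.a_closed Jt.I_l_closed Jt.a_inv_closed)
    ultimately have "G \<otimes> (q \<ominus> x \<otimes> b) \<in> J \<up> Suc t" by (simp only:)
    then have c: "q \<ominus> x \<otimes> b \<in> J \<up> Suc t"
      by (rule nzd_modD[OF nzd_mod_pow[OF assms]]) (use carr xc in simp)
    have "J \<up> Suc t \<subseteq> K \<cdot> ?I \<up> t"
      unfolding ideal_pow_Suc'[OF assms(2)]
      using K(2) I(2) by (intro ideal_prod_mono ideal_pow_mono) auto
    \<comment> \<open>Writing x b as a difference of two elements of K I^t makes the induction
      hypothesis applicable to b.\<close>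
    then have "q \<ominus> (q \<ominus> x \<otimes> b) \<in> K \<cdot> ?I \<up> t"
      using c pq(2) unfolding a_minus_def[of R q "q \<ominus> x \<otimes> b"] by (intro KIt.a_closed KIt.a_inv_closed) auto
    moreover have "q \<ominus> (q \<ominus> x \<otimes> b) = x \<otimes> b" using carr xc by algebra
    ultimately have b: "b \<in> K \<cdot> ?I \<up> t" using Suc.IH ab(2) by simp
    have "G \<otimes> b \<in> ?I \<cdot> (K \<cdot> ?I \<up> t)" using b I(3) by (intro ideal_prod.prod)
    also have "\<dots> = K \<cdot> ?I \<up> Suc t"
      using ideal_prod_assoc[OF I(1) K(1) It.is_ideal] ideal_prod_assoc[OF K(1) I(1) It.is_ideal]
        ideal_prod_commute[OF I(1) K(1)] ideal_pow_Suc'[OF I(1)] by simp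
    finally have Gb: "G \<otimes> b \<in> K \<cdot> ?I \<up> Suc t" .
    \<comment> \<open>Here G counts as an element of K, so the second summand of \<open>eq\<close>
      lies in K J^(t+1) as well.\<close>
    have "G \<otimes> (q \<ominus> x \<otimes> b) \<in> K \<cdot> J \<up> Suc t"
      using c I(3) K(2) by (intro ideal_prod.prod) auto
    then have "x \<otimes> a' \<in> K \<cdot> J \<up> Suc t" unfolding eq using pq(1) by (intro KJt.a_closed)
    then have "a' \<in> K \<cdot> J \<up> Suc t"
      using K I(2) by (intro nzd_liftsD[OF assms(1) K(1) _ x ab(1)]) auto
    also have "K \<cdot> J \<up> Suc t \<subseteq> K \<cdot> ?I \<up> Suc t" by (intro ideal_prod_mono ideal_pow_mono I order_refl)
    finally show ?case unfolding ab using Gb by (intro KIt'.a_closed)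
  qed
  show ?thesis
    unfolding nzd_lifts_def by (intro allI ballI impI) (rule lift)
qed

text \<open>If G x = a + G b is the splitting of an element of I^(t+1), then G (x - b) = a lies in
  J^(t+1). Cancelling G there puts x - b in J^(t+1), which is contained in I^t.\<close>

lemma colon_ideal_pow:
  assumes "nzd_lifts J" "ideal J R" "nzd_mod R J G" "x \<in> carrier R"
  shows "G \<otimes> x \<in> (J <+> PIdl G) \<up> Suc t \<longleftrightarrow> x \<in> (J <+> PIdl G) \<up> t"
proof
  let ?I = "J <+> PIdl G"
  have G: "G \<in> carrier R" using assms(3) by (simp add: nzd_mod_def)
  note I = ideal_add_PIdl[OF assms(2) G]
  interpret Jt: ideal "J \<up> Suc t" R by (intro ideal_pow_ideal assms)
  interpret It: ideal "?I \<up> t" R by (intro ideal_pow_ideal I)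
  {
    assume "G \<otimes> x \<in> ?I \<up> Suc t"
    then obtain a b where ab: "a \<in> J \<up> Suc t" "b \<in> ?I \<up> t" "G \<otimes> x = a \<oplus> G \<otimes> b"
      using ideal_pow_Suc_split[OF assms(2) G] by metis
    have carr: "a \<in> carrier R" "b \<in> carrier R" using ab Jt.Icarr It.Icarr by auto
    have "G \<otimes> (x \<ominus> b) = G \<otimes> x \<ominus> G \<otimes> b" using carr assms(4) G by algebra
    also have "\<dots> = a" unfolding ab using carr G by algebra
    finally have "G \<otimes> (x \<ominus> b) \<in> J \<up> Suc t" using ab(1) by (simp only:)
    then have "x \<ominus> b \<in> J \<up> Suc t"
      by (rule nzd_modD[OF nzd_mod_pow[OF assms(1-3)]]) (use carr assms(4) in simp)
    then have "x \<ominus> b \<in> ?I \<up> t"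
      using ideal_pow_mono[OF I(2)] ideal_pow_Suc_subset(1)[OF I(1)] by blast
    then have "(x \<ominus> b) \<oplus> b \<in> ?I \<up> t" using ab(2) by (intro It.a_closed)
    moreover have "(x \<ominus> b) \<oplus> b = x" using carr assms(4) by algebra
    ultimately show "x \<in> ?I \<up> t" by simp
  }
  assume "x \<in> ?I \<up> t"
  then show "G \<otimes> x \<in> ?I \<up> Suc t"
    unfolding ideal_pow_Suc'[OF I(1)] using I(3) by (intro ideal_prod.prod)
qed

text \<open>By the splitting, elements of I^(t+1) differ from elements of J^(t+1) by multiples of G,
  which the summand (G) absorbs.\<close>

lemma pow_Suc_add_PIdl:
  assumes "ideal J R" "G \<in> carrier R"
  shows "(J <+> PIdl G) \<up> Suc t <+> PIdl G = J \<up> Suc t <+> PIdl G"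
proof (intro Set.set_eqI iffI)
  let ?I = "J <+> PIdl G"
  note I = ideal_add_PIdl[OF assms]
  interpret Jt: ideal "J \<up> Suc t" R by (intro ideal_pow_ideal assms)
  interpret It': ideal "?I \<up> Suc t" R by (intro ideal_pow_ideal I)
  interpret It: ideal "?I \<up> t" R by (intro ideal_pow_ideal I)
  fix x
  {
    assume "x \<in> J \<up> Suc t <+> PIdl G"
    then show "x \<in> ?I \<up> Suc t <+> PIdl G"
      using ideal_pow_mono[OF I(2)] by (auto simp: set_add_def')
  }
  assume "x \<in> ?I \<up> Suc t <+> PIdl G"
  then obtain j r where jr: "j \<in> ?I \<up> Suc t" "r \<in> carrier R" "x = j \<oplus> G \<otimes> r"
    unfolding mem_add_PIdl_iff[OF It'.is_ideal assms(2)] by blast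
  obtain a b where ab: "a \<in> J \<up> Suc t" "b \<in> ?I \<up> t" "j = a \<oplus> G \<otimes> b"
    using ideal_pow_Suc_split[OF assms jr(1)] .
  have "x = a \<oplus> G \<otimes> (b \<oplus> r)"
    unfolding jr(3) ab(3) using Jt.Icarr[OF ab(1)] It.Icarr[OF ab(2)] jr(2) assms(2) by algebra
  then show "x \<in> J \<up> Suc t <+> PIdl G"
    unfolding mem_add_PIdl_iff[OF Jt.is_ideal assms(2)]
    by (intro bexI[of _ a] bexI[of _ "b \<oplus> r"]) (use ab(1) It.Icarr[OF ab(2)] jr(2) in simp_all)
qed

text \<open>Connects the quotient-ring condition inside \<open>regular_sequence\<close> with the
  elementwise one: if G y is in J, the product of the two cosets vanishes, and a coset equal to J
  has its representative in J.\<close>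

lemma nonzerodivisor_Quot:
  assumes "ideal J R" "G \<in> carrier R" "nonzerodivisor (R Quot J) (J +> G)"
  shows "nzd_mod R J G"
proof -
  interpret J: ideal J R by fact
  note hom = J.rcos_ring_hom
  have zero: "\<zero>\<^bsub>R Quot J\<^esub> = J" by (simp add: FactRing_def)
  have mem: "y \<in> J" if y: "y \<in> carrier R" "G \<otimes> y \<in> J" for y
  proof -
    have "(J +> G) \<otimes>\<^bsub>R Quot J\<^esub> (J +> y) = J"
      using a_rcos_zero[OF assms(1) y(2)] ring_hom_mult[OF hom assms(2) y(1)] by simp
    then have "J +> y = J"
      using assms(3) y(1) ring_hom_closed[OF hom y(1)] unfolding nonzerodivisor_def zero by blast
    then show ?thesis by (rule J.rcos_const_imp_mem[OF y(1)])
  qed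
  show ?thesis
    unfolding nzd_mod_def by (intro conjI ballI impI assms(2)) (rule mem)
qed

end

section \<open>The graded polynomial ring\<close>

lemma mpol_ring_simps [simp]:
  "monoid.mult (mpol_ring n) = (*)" "monoid.one (mpol_ring n) = 1" "ring.zero (mpol_ring n) = 0" "ring.add (mpol_ring n) = (+)"
  by (simp_all add: mpol_ring_def)

lemma mem_mpol_ring_iff: "p \<in> carrier (mpol_ring n) \<longleftrightarrow> (\<forall>m \<in> Poly_Mapping.keys p. Poly_Mapping.keys m \<subseteq> {0..n})"
  by (simp add: mpol_ring_def)

lemma mpol_ring_closed [simp]:
  "0 \<in> carrier (mpol_ring n)" "1 \<in> carrier (mpol_ring n)" "Poly_Mapping.single 0 c \<in> carrier (mpol_ring n)"
  by (auto simp: mem_mpol_ring_iff)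

lemma mpol_ring_add_closed [simp]:
  assumes "p \<in> carrier (mpol_ring n)" "q \<in> carrier (mpol_ring n)"
  shows "p + q \<in> carrier (mpol_ring n)"
  using assms keys_add[of p q] unfolding mem_mpol_ring_iff by blast

lemma mpol_ring_mult_closed [simp]:
  assumes "p \<in> carrier (mpol_ring n)" "q \<in> carrier (mpol_ring n)"
  shows "p * q \<in> carrier (mpol_ring n)"
  unfolding mem_mpol_ring_iff
proof
  fix m assume "m \<in> Poly_Mapping.keys (p * q)"
  then obtain a b where "a \<in> Poly_Mapping.keys p" "b \<in> Poly_Mapping.keys q" "m = a + b"
    using keys_mult[of p q] by auto
  then show "Poly_Mapping.keys m \<subseteq> {0..n}"
    using assms keys_add[of a b] unfolding mem_mpol_ring_iff by blast
qed

lemma mpol_ring_uminus_closed [simp]: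
  fixes p :: "'k::field mpol"
  shows "p \<in> carrier (mpol_ring n) \<Longrightarrow> - p \<in> carrier (mpol_ring n)"
  by (simp add: mem_mpol_ring_iff)

lemma mpol_ring_cring: "cring (mpol_ring n :: 'k::field mpol ring)"
proof (rule cringI)
  show "abelian_group (mpol_ring n :: 'k mpol ring)"
  proof (rule abelian_groupI)
    show "\<exists>q \<in> carrier (mpol_ring n). q \<oplus>\<^bsub>mpol_ring n\<^esub> p = \<zero>\<^bsub>mpol_ring n\<^esub>"
      if "p \<in> carrier (mpol_ring n)" for p :: "'k mpol"
      using that by (intro bexI[of _ "- p"]) auto
  qed (auto simp: algebra_simps)
  show "Group.comm_monoid (mpol_ring n :: 'k mpol ring)"
    by (rule comm_monoidI) (auto simp: algebra_simps)
qed (auto simp: algebra_simps)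

lemma mpol_ring_a_inv [simp]:
  fixes p :: "'k::field mpol"
  assumes "p \<in> carrier (mpol_ring n)" shows "\<ominus>\<^bsub>mpol_ring n\<^esub> p = - p"
proof -
  interpret cring "mpol_ring n :: 'k mpol ring" by (rule mpol_ring_cring)
  show ?thesis using assms by (intro minus_equality) auto
qed

lemma mpol_ring_minus [simp]:
  fixes p :: "'k::field mpol"
  assumes "q \<in> carrier (mpol_ring n)" shows "p \<ominus>\<^bsub>mpol_ring n\<^esub> q = p - q"
  using assms by (simp add: a_minus_def)

lemma mpol_ideal_closed:
  fixes J :: "'k::field mpol set"
  assumes "ideal J (mpol_ring n)"
  shows "0 \<in> J" "p \<in> J \<Longrightarrow> q \<in> J \<Longrightarrow> p + q \<in> J" "p \<in> J \<Longrightarrow> q \<in> J \<Longrightarrow> p - q \<in> J"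
    "p \<in> J \<Longrightarrow> - p \<in> J" "p \<in> carrier (mpol_ring n) \<Longrightarrow> q \<in> J \<Longrightarrow> p * q \<in> J"
    "p \<in> J \<Longrightarrow> p \<in> carrier (mpol_ring n)"
proof -
  note sub = ideal.axioms(1)[OF assms]
  show 0: "0 \<in> J" and 1: "p \<in> J \<Longrightarrow> p \<in> carrier (mpol_ring n)" for p using additive_subgroup.zero_closed[OF sub] ideal.Icarr[OF assms] by simp_all
  show 2: "p + q \<in> J" if "p \<in> J" "q \<in> J" for p q using additive_subgroup.a_closed[OF sub that] by simp
  show 3: "- p \<in> J" if "p \<in> J" for p using additive_subgroup.a_inv_closed[OF sub that] 1[OF that] by simp
  show "p - q \<in> J" if "p \<in> J" "q \<in> J" using 2[OF that(1) 3[OF that(2)]] by simp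
  show "p * q \<in> J" if "p \<in> carrier (mpol_ring n)" "q \<in> J" using ideal.I_l_closed[OF assms that(2,1)] by simp
qed

text \<open>Dimensions over a ring take their scalars from a subfield of it, so k enters as the
  constant polynomials.\<close>

lemma subfield_constants: "subfield (range (Poly_Mapping.single 0)) (mpol_ring n :: 'k::field mpol ring)"
proof -
  interpret cring "mpol_ring n :: 'k mpol ring" by (rule mpol_ring_cring)
  let ?K = "range (Poly_Mapping.single 0) :: 'k mpol set"
  have "subring ?K (mpol_ring n)"
  proof (rule subringI)
    show "\<one>\<^bsub>mpol_ring n\<^esub> \<in> ?K" by (rule image_eqI[of _ _ 1]) simp_all
  qed (auto simp: image_iff mult_single single_add[symmetric] single_uminus[symmetric])
  then have "subcring ?K (mpol_ring n)" by (rule subcringI) (auto simp: mult.commute)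
  moreover have "Units (mpol_ring n \<lparr>carrier := ?K\<rparr>) = ?K - {0}"
  proof (intro Set.set_eqI iffI)
    fix p assume "p \<in> ?K - {0}"
    then obtain c where c: "p = Poly_Mapping.single 0 c" "c \<noteq> 0" by (metis DiffD1 DiffD2 rangeE singletonI single_zero)
    then have "Poly_Mapping.single 0 (inverse c) * p = 1" "p * Poly_Mapping.single 0 (inverse c) = 1"
      by (simp_all add: mult_single)
    then show "p \<in> Units (mpol_ring n \<lparr>carrier := ?K\<rparr>)" using c by (auto simp: Units_def)
  qed (auto simp: Units_def)
  ultimately show ?thesis by (intro subfieldI) simp_all
qed

section \<open>Degrees and forms\<close>

lemma total_degree_eq_sum:
  assumes "finite A" "Poly_Mapping.keys m \<subseteq> A"
  shows "total_degree m = (\<Sum>j \<in> A. Poly_Mapping.lookup m j)"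
  unfolding total_degree_def using assms by (intro sum.mono_neutral_left) (auto simp: in_keys_iff)

lemma total_degree_add: "total_degree (a + b) = total_degree a + total_degree b"
  using keys_add[of a b]
  by (simp add: total_degree_eq_sum[of "Poly_Mapping.keys a \<union> Poly_Mapping.keys b"] lookup_add sum.distrib)

lemma formsD:
  assumes "p \<in> forms n d"
  shows "p \<in> carrier (mpol_ring n)" "m \<in> Poly_Mapping.keys p \<Longrightarrow> total_degree m = d"
  using assms by (auto simp: forms_def)

lemma forms_closed:
  fixes p :: "'k::field mpol"
  shows "0 \<in> forms n d" "p \<in> forms n d \<Longrightarrow> q \<in> forms n d \<Longrightarrow> p + q \<in> forms n d"
    "p \<in> forms n d \<Longrightarrow> Poly_Mapping.single 0 c * p \<in> forms n d"
    "p \<in> forms n d \<Longrightarrow> - p \<in> forms n d"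
    "p \<in> forms n d \<Longrightarrow> q \<in> forms n d \<Longrightarrow> p - q \<in> forms n d"
proof -
  show "0 \<in> forms n d" by (simp add: forms_def)
  show 1: "p + q \<in> forms n d" if "p \<in> forms n d" "q \<in> forms n d" for p q :: "'k mpol"
    using that keys_add[of p q] by (auto simp: forms_def)
  show 2: "- p \<in> forms n d" if "p \<in> forms n d" for p :: "'k mpol"
    using that by (auto simp: forms_def)
  show "p - q \<in> forms n d" if "p \<in> forms n d" "q \<in> forms n d"
    using 1[OF that(1) 2[OF that(2)]] by simp
  show "Poly_Mapping.single 0 c * p \<in> forms n d" if "p \<in> forms n d"
    using that keys_mult[of "Poly_Mapping.single 0 c" p] by (auto simp: forms_def split: if_splits)
qed

lemma forms_mult:
  assumes "p \<in> forms n d" "q \<in> forms n e"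
  shows "p * q \<in> forms n (d + e)"
proof -
  have "total_degree m = d + e" if "m \<in> Poly_Mapping.keys (p * q)" for m
    using that keys_mult[of p q] formsD(2)[OF assms(1)] formsD(2)[OF assms(2)] by (auto simp: total_degree_add)
  then show ?thesis using assms by (simp add: forms_def)
qed

section \<open>Homogeneous parts\<close>

definition homog_part :: "nat \<Rightarrow> 'k::field mpol \<Rightarrow> 'k mpol" where
  "homog_part d p =
     (\<Sum>m \<in> {m \<in> Poly_Mapping.keys p. total_degree m = d}. Poly_Mapping.single m (Poly_Mapping.lookup p m))"

lemma lookup_homog_part: "Poly_Mapping.lookup (homog_part d p) m = (Poly_Mapping.lookup p m when total_degree m = d)"
proof -
  have "Poly_Mapping.lookup (homog_part d p) m =
      (\<Sum>m' \<in> {m \<in> Poly_Mapping.keys p. total_degree m = d}. if m' = m then Poly_Mapping.lookup p m else 0)"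
    unfolding homog_part_def lookup_sum by (intro sum.cong) (auto simp: lookup_single)
  then show ?thesis by (auto simp: when_def in_keys_iff)
qed

lemma homog_part_add: "homog_part d (p + q) = homog_part d p + homog_part d q"
  by (intro poly_mapping_eqI) (simp add: lookup_homog_part lookup_add when_add_distrib)

lemma homog_part_0 [simp]: "homog_part d 0 = 0"
  by (simp add: homog_part_def)

lemma homog_part_sum: "homog_part d (\<Sum>x \<in> A. f x) = (\<Sum>x \<in> A. homog_part d (f x))"
  by (induction A rule: infinite_finite_induct) (auto simp: homog_part_add)

lemma homog_part_mem_forms:
  assumes "p \<in> carrier (mpol_ring n)" shows "homog_part d p \<in> forms n d"
  using assms by (auto simp: forms_def mem_mpol_ring_iff in_keys_iff lookup_homog_part)

lemma homog_part_form:
  assumes "p \<in> forms n d" shows "homog_part e p = (if e = d then p else 0)"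
  by (intro poly_mapping_eqI) (use assms in \<open>auto simp: lookup_homog_part when_def in_keys_iff dest!: formsD(2)\<close>)

lemma sum_homog_part: "(\<Sum>d \<in> total_degree ` Poly_Mapping.keys p. homog_part d p) = p"
proof (intro poly_mapping_eqI)
  fix m
  have "(\<Sum>d \<in> total_degree ` Poly_Mapping.keys p. Poly_Mapping.lookup p m when total_degree m = d) =
      (\<Sum>d \<in> total_degree ` Poly_Mapping.keys p. if d = total_degree m then Poly_Mapping.lookup p m else 0)"
    by (intro sum.cong) (auto simp: when_def)
  also have "\<dots> = Poly_Mapping.lookup p m" by (auto simp: in_keys_iff)
  finally show "Poly_Mapping.lookup (\<Sum>d \<in> total_degree ` Poly_Mapping.keys p. homog_part d p) m = Poly_Mapping.lookup p m"
    by (simp add: lookup_sum lookup_homog_part)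
qed

text \<open>F times the part of \<open>g\<close> of degree k is a form of degree d + k, so only k =
  e - d contributes in degree e.\<close>

lemma homog_part_mult_form:
  assumes "F \<in> forms n d" "g \<in> carrier (mpol_ring n)"
  shows "homog_part e (F * g) = (if d \<le> e then F * homog_part (e - d) g else 0)"
proof -
  let ?D = "total_degree ` Poly_Mapping.keys g"
  have "homog_part e (F * g) = homog_part e (\<Sum>k \<in> ?D. F * homog_part k g)"
    by (simp only: sum_distrib_left[symmetric] sum_homog_part)
  also have "\<dots> = (\<Sum>k \<in> ?D. if e = d + k then F * homog_part k g else 0)"
    unfolding homog_part_sum
    using homog_part_form[OF forms_mult[OF assms(1) homog_part_mem_forms[OF assms(2)]]] by simp
  also have "\<dots> = (if d \<le> e then F * homog_part (e - d) g else 0)"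
  proof (cases "d \<le> e")
    case True
    \<comment> \<open>The degree e - d need not occur in \<open>g\<close>; the sum is then 0, and so
      is the part on the right.\<close>
    have "homog_part (e - d) g = 0" if "e - d \<notin> ?D"
    proof -
      have "{m \<in> Poly_Mapping.keys g. total_degree m = e - d} = {}" using that by (force simp: image_iff)
      then show ?thesis by (simp only: homog_part_def sum.empty)
    qed
    moreover have "(\<Sum>k \<in> ?D. if e = d + k then F * homog_part k g else 0) =
        (\<Sum>k \<in> ?D. if k = e - d then F * homog_part (e - d) g else 0)"
      using True by (intro sum.cong) auto
    ultimately show ?thesis using True by auto
  qed auto
  finally show ?thesis .
qed

text \<open>Closure under homogeneous parts replaces the existence of homogeneous generators: it is
  what allows an equation modulo J to be projected to a single degree.\<close>

definition homogeneous :: "'k::field mpol set \<Rightarrow> bool" where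
  "homogeneous J \<longleftrightarrow> (\<forall>p \<in> J. \<forall>d. homog_part d p \<in> J)"

text \<open>Split an element of I^(t+1) as a + F b. The parts of a stay in J^(t+1) by assumption,
  and those of F b are F times parts of b, which lie in I^t by induction, or 0.\<close>

lemma homogeneous_ideal_pow:
  fixes J :: "'k::field mpol set"
  assumes "ideal J (mpol_ring n)" "F \<in> forms n d" "\<And>t. homogeneous (J \<up>\<^bsub>mpol_ring n\<^esub> Suc t)"
  shows "homogeneous ((J <+>\<^bsub>mpol_ring n\<^esub> PIdl\<^bsub>mpol_ring n\<^esub> F) \<up>\<^bsub>mpol_ring n\<^esub> t)"
proof -
  interpret cring "mpol_ring n :: 'k mpol ring" by (rule mpol_ring_cring)
  let ?I = "J <+>\<^bsub>mpol_ring n\<^esub> PIdl\<^bsub>mpol_ring n\<^esub> F"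
  have F: "F \<in> carrier (mpol_ring n)" using assms(2) by (rule formsD)
  note I = ideal_add_PIdl[OF assms(1) F]
  have "homogeneous (?I \<up>\<^bsub>mpol_ring n\<^esub> t)"
  proof (induction t)
    case 0
    then show ?case using homog_part_mem_forms formsD(1) by (simp add: homogeneous_def) blast
  next
    case (Suc t)
    have It: "ideal (?I \<up>\<^bsub>mpol_ring n\<^esub> t) (mpol_ring n)" for t using I(1) by (rule ideal_pow_ideal)
    show ?case unfolding homogeneous_def
    proof (intro ballI allI)
      fix x e assume "x \<in> ?I \<up>\<^bsub>mpol_ring n\<^esub> Suc t"
      then obtain a b where ab: "a \<in> J \<up>\<^bsub>mpol_ring n\<^esub> Suc t" "b \<in> ?I \<up>\<^bsub>mpol_ring n\<^esub> t" "x = a + F * b"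
        by (rule ideal_pow_Suc_split[OF assms(1) F]) simp
      have "homog_part e a \<in> J \<up>\<^bsub>mpol_ring n\<^esub> Suc t"
        using assms(3) ab(1) by (auto simp: homogeneous_def)
      then have 1: "homog_part e a \<in> ?I \<up>\<^bsub>mpol_ring n\<^esub> Suc t" using ideal_pow_mono[OF I(2)] by blast
      have "F * y \<in> ?I \<up>\<^bsub>mpol_ring n\<^esub> Suc t" if "y \<in> ?I \<up>\<^bsub>mpol_ring n\<^esub> t" for y
        using ideal_prod.prod[OF I(3) that, of "mpol_ring n"] by (simp add: ideal_pow_Suc'[OF I(1)])
      then have 2: "homog_part e (F * b) \<in> ?I \<up>\<^bsub>mpol_ring n\<^esub> Suc t"
        using homog_part_mult_form[OF assms(2) mpol_ideal_closed(6)[OF It ab(2)]] Suc.IH ab(2) mpol_ideal_closed(1)[OF It]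
        by (simp add: homogeneous_def)
      show "homog_part e x \<in> ?I \<up>\<^bsub>mpol_ring n\<^esub> Suc t"
        unfolding ab homog_part_add by (rule mpol_ideal_closed(2)[OF It 1 2])
    qed
  qed
  then show ?thesis .
qed

section \<open>Bases of graded pieces\<close>

text \<open>Scalars act as constant polynomials. Since \<open>zip\<close> cuts to the shorter list,
  the notions built on this one ask for equal lengths.\<close>

definition lincomb :: "'k::field list \<Rightarrow> 'k mpol list \<Rightarrow> 'k mpol" where
  "lincomb cs us = (\<Sum>(c, u) \<leftarrow> zip cs us. Poly_Mapping.single 0 c * u)"

lemma lincomb_Nil [simp]: "lincomb [] us = 0" "lincomb cs [] = 0"
  and lincomb_Cons [simp]: "lincomb (c # cs) (u # us) = Poly_Mapping.single 0 c * u + lincomb cs us"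
  by (simp_all add: lincomb_def)

lemma lincomb_append:
  "length cs = length us \<Longrightarrow> lincomb (cs @ cs') (us @ us') = lincomb cs us + lincomb cs' us'"
  by (simp add: lincomb_def)

lemma lincomb_map_mult: "lincomb cs (map ((*) F) us) = F * lincomb cs us"
proof (induction cs arbitrary: us)
  case (Cons c cs)
  then show ?case by (cases us) (simp_all add: algebra_simps)
qed simp

lemma lincomb_zero: "set cs \<subseteq> {0} \<Longrightarrow> lincomb cs us = 0"
proof (induction cs arbitrary: us)
  case (Cons c cs)
  then show ?case by (cases us) simp_all
qed simp

lemma lincomb_mem_forms:
  "set us \<subseteq> forms n d \<Longrightarrow> lincomb cs us \<in> forms n d"
proof (induction cs arbitrary: us)
  case (Cons c cs)
  then show ?case by (cases us) (simp_all add: forms_closed)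
qed (simp add: forms_closed)

definition independent_mod :: "'k::field mpol set \<Rightarrow> 'k mpol list \<Rightarrow> bool" where
  "independent_mod J us \<longleftrightarrow> (\<forall>cs. length cs = length us \<longrightarrow> lincomb cs us \<in> J \<longrightarrow> set cs \<subseteq> {0})"

text \<open>The cosets of \<open>us\<close> are meant as a basis of the degree d piece of R/J.
  Working with representatives and scalars from k allows bases for different quotients to be
  concatenated.\<close>

definition basis_mod :: "nat \<Rightarrow> 'k::field mpol set \<Rightarrow> nat \<Rightarrow> 'k mpol list \<Rightarrow> bool" where
  "basis_mod n J d us \<longleftrightarrow> set us \<subseteq> forms n d \<and> independent_mod J us \<and>
     (\<forall>p \<in> forms n d. \<exists>cs. length cs = length us \<and> p - lincomb cs us \<in> J)"

text \<open>Each exponent is bounded by the total degree, so \<open>lookup\<close> embeds these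
  monomials into the finitely many functions from {0..n} to {0..d}, extended by 0.\<close>

lemma finite_monomials: "finite {m. Poly_Mapping.keys m \<subseteq> {0..n} \<and> total_degree m = d}"
proof (rule finite_imageD)
  let ?S = "{f. \<forall>x. (x \<in> {0..n} \<longrightarrow> f x \<in> {0..d}) \<and> (x \<notin> {0..n} \<longrightarrow> f x = (0 :: nat))}"
  have "Poly_Mapping.lookup m x \<le> total_degree m" for m x
    using member_le_sum[of x "Poly_Mapping.keys m" "Poly_Mapping.lookup m"]
    by (cases "x \<in> Poly_Mapping.keys m") (auto simp: total_degree_def in_keys_iff)
  then show "finite (Poly_Mapping.lookup ` {m. Poly_Mapping.keys m \<subseteq> {0..n} \<and> total_degree m = d})"
    by (intro finite_subset[OF _ finite_set_of_finite_funs[of "{0..n}" "{0..d}" 0]]) (auto simp: in_keys_iff)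
  show "inj_on Poly_Mapping.lookup {m. Poly_Mapping.keys m \<subseteq> {0..n} \<and> total_degree m = d}"
    by (simp add: inj_on_def poly_mapping.lookup_inject)
qed

text \<open>The monomials of degree d span, and the coordinates of a form are its
  coefficients.\<close>

lemma forms_finitely_spanned:
  obtains us :: "'k::field mpol list"
  where "set us \<subseteq> forms n d" "\<forall>p \<in> forms n d. \<exists>cs. length cs = length us \<and> p = lincomb cs us"
proof -
  let ?M = "{m. Poly_Mapping.keys m \<subseteq> {0..n} \<and> total_degree m = d}"
  obtain ms where ms: "set ms = ?M" "distinct ms"
    using finite_distinct_list[OF finite_monomials] by blast
  let ?us = "map (\<lambda>m. Poly_Mapping.single m 1) ms :: 'k mpol list"
  have lin: "lincomb (map (Poly_Mapping.lookup p) ms) (map (\<lambda>m. Poly_Mapping.single m 1) ms) =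
      (\<Sum>m \<leftarrow> ms. Poly_Mapping.single m (Poly_Mapping.lookup p m))" for p :: "'k mpol" and ms
    by (induction ms) (simp_all add: mult_single)
  have "p = lincomb (map (Poly_Mapping.lookup p) ms) ?us" if p: "p \<in> forms n d" for p
  proof -
    have "lincomb (map (Poly_Mapping.lookup p) ms) ?us = (\<Sum>m \<in> ?M. Poly_Mapping.single m (Poly_Mapping.lookup p m))"
      unfolding lin using ms by (simp add: sum_list_distinct_conv_sum_set)
    also have "\<dots> = p"
    proof (rule poly_mapping_eqI)
      fix m
      have "Poly_Mapping.lookup p m = 0" if "m \<notin> ?M"
        using that p by (auto simp: forms_def mem_mpol_ring_iff in_keys_iff)
      moreover have "(\<Sum>m' \<in> ?M. Poly_Mapping.lookup p m' when m' = m) = (\<Sum>m' \<in> ?M. if m' = m then Poly_Mapping.lookup p m else 0)"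
        by (intro sum.cong) auto
      ultimately show "Poly_Mapping.lookup (\<Sum>m \<in> ?M. Poly_Mapping.single m (Poly_Mapping.lookup p m)) m = Poly_Mapping.lookup p m"
        using finite_monomials[of n d] by (auto simp: lookup_sum lookup_single)
    qed
    finally show ?thesis ..
  qed
  then have "\<exists>cs. length cs = length ?us \<and> p = lincomb cs ?us" if "p \<in> forms n d" for p
    using that by (intro exI[of _ "map (Poly_Mapping.lookup p) ms"]) simp
  moreover have "set ?us \<subseteq> forms n d"
    using ms by (auto simp: forms_def mem_mpol_ring_iff)
  ultimately show ?thesis using that by blast
qed

section \<open>Graded pieces of the quotient by a proper ideal as vector spaces\<close>

lemma scalars_mod_image: "scalars_mod n J = (+>\<^bsub>mpol_ring n\<^esub>) J ` range (Poly_Mapping.single 0)"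
  unfolding scalars_mod_def by auto

lemma list_imageE:
  assumes "set xs \<subseteq> f ` A"
  obtains ys where "set ys \<subseteq> A" "xs = map f ys" "length ys = length xs"
proof -
  have "xs \<in> lists (f ` A)" using assms by auto
  then show ?thesis using that by (auto simp: lists_image)
qed

context
  fixes n :: nat and J :: "'k::field mpol set"
  assumes J: "ideal J (mpol_ring n)" "J \<noteq> carrier (mpol_ring n)"
begin

abbreviation "QR \<equiv> mpol_ring n Quot J"
abbreviation "coset \<equiv> (+>\<^bsub>mpol_ring n\<^esub>) J"

lemma quot_ring: "ring QR"
  using J(1) by (rule ideal.quotient_is_ring)

lemma quot_zero: "\<zero>\<^bsub>QR\<^esub> = J"
  by (simp add: FactRing_def)

lemma quot_hom: "coset \<in> ring_hom (mpol_ring n) QR"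
  using J(1) by (rule ideal.rcos_ring_hom)

lemma coset_eq_iff:
  assumes "p \<in> carrier (mpol_ring n)" "q \<in> carrier (mpol_ring n)"
  shows "coset p = coset q \<longleftrightarrow> p - q \<in> J"
  using ring.quotient_eq_iff_same_a_r_cos[OF cring.axioms(1)[OF mpol_ring_cring] J(1) assms] assms by simp

lemma coset_eq_zero_iff:
  assumes "p \<in> carrier (mpol_ring n)" shows "coset p = J \<longleftrightarrow> p \<in> J"
proof -
  have "coset 0 = J"
    using ring.a_rcos_zero[OF cring.axioms(1)[OF mpol_ring_cring] J(1) mpol_ideal_closed(1)[OF J(1)]] .
  then show ?thesis using coset_eq_iff[OF assms, of 0] by simp
qed

text \<open>A non-zero constant is a unit, so it would make J the whole ring. Properness of J thus
  makes the passage from k to the scalars modulo J injective.\<close>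

lemma constant_mem_iff: "Poly_Mapping.single 0 c \<in> J \<longleftrightarrow> c = 0"
proof
  assume c: "Poly_Mapping.single 0 c \<in> J"
  show "c = 0"
  proof (rule ccontr)
    assume "c \<noteq> 0"
    then have "1 \<in> J"
      using mpol_ideal_closed(5)[OF J(1) _ c, of "Poly_Mapping.single 0 (inverse c)"] by (simp add: mult_single)
    then show False
      using ideal.one_imp_carrier[OF J(1)] J(2) by simp
  qed
qed (simp add: mpol_ideal_closed[OF J(1)])

lemma quot_subfield: "subfield (scalars_mod n J) QR"
  unfolding scalars_mod_image
proof (rule ring_hom_ring.img_is_subfield(2)[OF _ subfield_constants])
  show "ring_hom_ring (mpol_ring n) QR coset"
    using J(1) by (rule ideal.rcos_ring_hom_ring)
  have "coset 1 \<noteq> J"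
    using coset_eq_zero_iff[of 1] constant_mem_iff[of 1] by simp
  then show "\<one>\<^bsub>QR\<^esub> \<noteq> \<zero>\<^bsub>QR\<^esub>"
    using ring_hom_one[OF quot_hom] by (simp add: quot_zero)
qed

lemma quot_combine:
  assumes "length cs = length us" "set us \<subseteq> carrier (mpol_ring n)"
  shows "ring.combine QR (map (\<lambda>c. coset (Poly_Mapping.single 0 c)) cs) (map coset us) = coset (lincomb cs us)"
    and "lincomb cs us \<in> carrier (mpol_ring n)"
proof -
  have "ring.combine QR (map (\<lambda>c. coset (Poly_Mapping.single 0 c)) cs) (map coset us) = coset (lincomb cs us) \<and>
    lincomb cs us \<in> carrier (mpol_ring n)"
    using assms
  proof (induction rule: list_induct2)
    case Nil
    then show ?case using coset_eq_zero_iff[of 0] mpol_ideal_closed(1)[OF J(1)] by (simp add: ring.combine.simps[OF quot_ring] quot_zero)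
  next
    case (Cons c cs u us)
    then show ?case
      using ring_hom_add[OF quot_hom, of "Poly_Mapping.single 0 c * u" "lincomb cs us"]
        ring_hom_mult[OF quot_hom, of "Poly_Mapping.single 0 c" u]
      by (simp add: ring.combine.simps[OF quot_ring])
  qed
  then show "ring.combine QR (map (\<lambda>c. coset (Poly_Mapping.single 0 c)) cs) (map coset us) = coset (lincomb cs us)"
    and "lincomb cs us \<in> carrier (mpol_ring n)" by auto
qed

lemma scalars_mod_lists:
  assumes "set Ks \<subseteq> scalars_mod n J"
  obtains cs where "Ks = map (\<lambda>c. coset (Poly_Mapping.single 0 c)) cs"
  using assms list_imageE[of Ks "\<lambda>c. coset (Poly_Mapping.single 0 c)" UNIV] unfolding scalars_mod_def by metis

lemma scalar_zero_iff: "coset (Poly_Mapping.single 0 c) = J \<longleftrightarrow> c = 0"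
  using coset_eq_zero_iff constant_mem_iff by simp

lemma quot_Span:
  assumes "set us \<subseteq> forms n d"
  shows "ring.Span QR (scalars_mod n J) (map coset us) = {coset (lincomb cs us) |cs. length cs = length us}"
proof -
  have us: "set us \<subseteq> carrier (mpol_ring n)" using assms formsD(1) by blast
  then have Us: "set (map coset us) \<subseteq> carrier QR" using ring_hom_closed[OF quot_hom] by auto
  show ?thesis
    unfolding ring.Span_eq_combine_set_length_version[OF quot_ring quot_subfield Us]
  proof (intro Set.set_eqI iffI)
    fix x assume "x \<in> {ring.combine QR Ks (map coset us) |Ks. length Ks = length (map coset us) \<and> set Ks \<subseteq> scalars_mod n J}"
    then obtain Ks where Ks: "x = ring.combine QR Ks (map coset us)" "length Ks = length us" "set Ks \<subseteq> scalars_mod n J"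
      by auto
    then show "x \<in> {coset (lincomb cs us) |cs. length cs = length us}"
      using quot_combine(1)[OF _ us] by (auto elim!: scalars_mod_lists)
  next
    fix x assume "x \<in> {coset (lincomb cs us) |cs. length cs = length us}"
    then obtain cs where cs: "x = coset (lincomb cs us)" "length cs = length us" by auto
    then have "x = ring.combine QR (map (\<lambda>c. coset (Poly_Mapping.single 0 c)) cs) (map coset us)"
      using quot_combine(1)[OF _ us] by simp
    moreover have "set (map (\<lambda>c. coset (Poly_Mapping.single 0 c)) cs) \<subseteq> scalars_mod n J" by (auto simp: scalars_mod_def)
    ultimately show "x \<in> {ring.combine QR Ks (map coset us) |Ks. length Ks = length (map coset us) \<and> set Ks \<subseteq> scalars_mod n J}"
      using cs(2) by (metis (mono_tags, lifting) length_map mem_Collect_eq)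
  qed
qed

lemma Span_eq_forms_mod_iff:
  assumes "set us \<subseteq> forms n d"
  shows "ring.Span QR (scalars_mod n J) (map coset us) = forms_mod n J d \<longleftrightarrow>
    (\<forall>p \<in> forms n d. \<exists>cs. length cs = length us \<and> p - lincomb cs us \<in> J)"
proof -
  have lin: "lincomb cs us \<in> forms n d" for cs using assms by (rule lincomb_mem_forms)
  define S where "S = {coset (lincomb cs us) |cs. length cs = length us}"
  have "S \<subseteq> forms_mod n J d"
    using lin by (auto simp: S_def forms_mod_def)
  then have "S = forms_mod n J d \<longleftrightarrow> (\<forall>p \<in> forms n d. coset p \<in> S)"
    unfolding forms_mod_def by blast
  moreover have "coset p \<in> S \<longleftrightarrow> (\<exists>cs. length cs = length us \<and> p - lincomb cs us \<in> J)"
    if "p \<in> forms n d" for p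
    using coset_eq_iff[OF formsD(1)[OF that] formsD(1)[OF lin]] by (auto simp: S_def)
  ultimately show ?thesis unfolding quot_Span[OF assms] S_def[symmetric] by simp
qed

text \<open>A relation between the cosets is a linear combination of \<open>us\<close> lying in J,
  and a scalar vanishes modulo J only if it is 0.\<close>

lemma quot_independent_iff:
  assumes "set us \<subseteq> forms n d"
  shows "ring.independent QR (scalars_mod n J) (map coset us) \<longleftrightarrow> independent_mod J us"
proof
  have us: "set us \<subseteq> carrier (mpol_ring n)" using assms formsD(1) by blast
  then have Us: "set (map coset us) \<subseteq> carrier QR" using ring_hom_closed[OF quot_hom] by auto
  let ?c = "\<lambda>c. coset (Poly_Mapping.single 0 c)"
  {
    assume ind: "ring.independent QR (scalars_mod n J) (map coset us)"
    show "independent_mod J us"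
      unfolding independent_mod_def
    proof (intro allI impI)
      fix cs assume cs: "length cs = length us" "lincomb cs us \<in> J"
      have "ring.combine QR (map ?c cs) (map coset us) = \<zero>\<^bsub>QR\<^esub>"
        unfolding quot_combine(1)[OF cs(1) us] quot_zero using coset_eq_zero_iff[OF quot_combine(2)[OF cs(1) us]] cs(2) by simp
      moreover have "set (map ?c cs) \<subseteq> scalars_mod n J" by (auto simp: scalars_mod_def)
      ultimately have "set (take (length (map coset us)) (map ?c cs)) \<subseteq> {\<zero>\<^bsub>QR\<^esub>}"
        by (intro ring.independent_imp_trivial_combine[OF quot_ring quot_subfield ind])
      then have "?c ` set cs \<subseteq> {J}" using cs(1) by (simp add: quot_zero)
      then show "set cs \<subseteq> {0}" by (auto simp: scalar_zero_iff)
    qed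
  }
  assume ind: "independent_mod J us"
  show "ring.independent QR (scalars_mod n J) (map coset us)"
  proof (rule ring.trivial_combine_imp_independent[OF quot_ring quot_subfield Us])
    fix Ks assume Ks: "set Ks \<subseteq> scalars_mod n J" "ring.combine QR Ks (map coset us) = \<zero>\<^bsub>QR\<^esub>"
    let ?t = "take (length (map coset us)) Ks"
    \<comment> \<open>The criterion for independence admits coefficient lists of any length, whereas
      \<open>lincomb\<close> is used with lists as long as \<open>us\<close>. Truncating and padding
      with zeros leaves the combination unchanged.\<close>
    let ?k = "?t @ replicate (length us - length ?t) \<zero>\<^bsub>QR\<^esub>"
    have "\<zero>\<^bsub>QR\<^esub> \<in> scalars_mod n J" unfolding quot_zero scalars_mod_def using scalar_zero_iff[of 0] by (metis rangeI)
    then have "set ?k \<subseteq> scalars_mod n J" using Ks(1) set_take_subset[of _ Ks] by auto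
    then obtain cs where cs: "?k = map ?c cs" by (elim scalars_mod_lists)
    have len: "length cs = length us" using arg_cong[OF cs, of length] by simp
    have "coset (lincomb cs us) = ring.combine QR ?k (map coset us)"
      unfolding cs quot_combine(1)[OF len us] ..
    also have "\<dots> = ring.combine QR ?t (map coset us)"
      by (rule ring.combine_append_replicate[OF quot_ring Us])
    also have "\<dots> = J" using Ks(2) unfolding ring.combine_take[OF quot_ring] quot_zero .
    finally have "lincomb cs us \<in> J"
      using coset_eq_zero_iff[OF quot_combine(2)[OF len us]] by simp
    then have "set cs \<subseteq> {0}" using ind len unfolding independent_mod_def by blast
    then have "set (map ?c cs) \<subseteq> {J}" using scalar_zero_iff by auto
    then show "set ?t \<subseteq> {\<zero>\<^bsub>QR\<^esub>}" unfolding cs[symmetric] quot_zero by simp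
  qed
qed

lemma hilbert_function_eq_length:
  assumes "basis_mod n J d us" shows "hilbert_function n J (int d) = length us"
proof -
  have us: "set us \<subseteq> forms n d" using assms by (simp add: basis_mod_def)
  have "ring.dimension QR (length (map coset us)) (scalars_mod n J) (forms_mod n J d)"
    using assms quot_independent_iff[OF us] Span_eq_forms_mod_iff[OF us]
    by (intro ring.dimensionI[OF quot_ring quot_subfield]) (auto simp: basis_mod_def)
  then show ?thesis
    using ring.dimI[OF quot_ring quot_subfield] by (simp add: hilbert_function_def)
qed

text \<open>The cosets of a finite spanning list of forms can be exchanged for an independent list
  with the same span; its members are again cosets of forms and lift to forms.\<close>

lemma basis_mod_exists: "\<exists>us. basis_mod n J d us"
proof -
  obtain ws :: "'k mpol list" where ws: "set ws \<subseteq> forms n d"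
      "\<forall>p \<in> forms n d. \<exists>cs. length cs = length ws \<and> p = lincomb cs ws"
    by (rule forms_finitely_spanned[of n d])
  have "set (map coset ws) \<subseteq> carrier QR"
    using subsetD[OF ws(1)] ring_hom_closed[OF quot_hom formsD(1)] by auto
  then obtain Vs where Vs: "set Vs \<subseteq> carrier QR" "ring.independent QR (scalars_mod n J) Vs"
      "ring.Span QR (scalars_mod n J) Vs = ring.Span QR (scalars_mod n J) (map coset ws)"
    by (rule ring.filter_base[OF quot_ring quot_subfield])
  have "ring.Span QR (scalars_mod n J) (map coset ws) = forms_mod n J d"
    unfolding Span_eq_forms_mod_iff[OF ws(1)] using ws(2) mpol_ideal_closed(1)[OF J(1)] by fastforce
  then have span: "ring.Span QR (scalars_mod n J) Vs = forms_mod n J d" using Vs(3) by simp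
  then have "set Vs \<subseteq> coset ` forms n d"
    using ring.Span_base_incl[OF quot_ring quot_subfield Vs(1)] by (simp add: forms_mod_def)
  then obtain us where us: "set us \<subseteq> forms n d" "Vs = map coset us" by (rule list_imageE)
  then have "basis_mod n J d us"
    using quot_independent_iff[OF us(1)] Span_eq_forms_mod_iff[OF us(1)] Vs(2) span by (simp add: basis_mod_def)
  then show ?thesis by blast
qed

end

text \<open>Since B : F = A and C = B + (F), multiplication by F gives an exact sequence 0 ->
  (R/A)(-d) -> R/B -> R/C -> 0. The basis in the middle consists of the image of the left basis and
  a lift of the right one.\<close>

lemma basis_mod_append:
  fixes A B C :: "'k::field mpol set"
  assumes A: "ideal A (mpol_ring n)" and B: "ideal B (mpol_ring n)" "homogeneous B" and F: "F \<in> forms n d"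
    and colon: "\<And>x. x \<in> carrier (mpol_ring n) \<Longrightarrow> F * x \<in> B \<longleftrightarrow> x \<in> A"
    and C: "C = B <+>\<^bsub>mpol_ring n\<^esub> PIdl\<^bsub>mpol_ring n\<^esub> F"
    and us: "d \<le> e \<Longrightarrow> basis_mod n A (e - d) us" "\<not> d \<le> e \<Longrightarrow> us = []"
    and vs: "basis_mod n C e vs"
  shows "basis_mod n B e (map ((*) F) us @ vs)"
proof -
  interpret R: cring "mpol_ring n :: 'k mpol ring" by (rule mpol_ring_cring)
  have Fc: "F \<in> carrier (mpol_ring n)" using F by (rule formsD)
  have memC: "x \<in> C \<longleftrightarrow> (\<exists>b \<in> B. \<exists>r \<in> carrier (mpol_ring n). x = b + F * r)" for x
    unfolding C using R.mem_add_PIdl_iff[OF B(1) Fc] by simp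
  have us_forms: "set us \<subseteq> forms n (e - d)" using us by (cases "d \<le> e") (auto simp: basis_mod_def)
  have uc: "lincomb cs us \<in> carrier (mpol_ring n)" for cs
    using lincomb_mem_forms[OF us_forms] by (rule formsD)
  have vs_forms: "set vs \<subseteq> forms n e" using vs by (simp add: basis_mod_def)
  have "set (map ((*) F) us) \<subseteq> forms n e"
  proof (cases "d \<le> e")
    case True
    then show ?thesis using forms_mult[OF F, of _ "e - d"] us_forms by auto
  qed (use us in simp)
  moreover have "independent_mod B (map ((*) F) us @ vs)"
    unfolding independent_mod_def
  proof (intro allI impI)
    fix cs assume cs: "length cs = length (map ((*) F) us @ vs)" "lincomb cs (map ((*) F) us @ vs) \<in> B"
    define a b where "a = take (length us) cs" and "b = drop (length us) cs"
    have ab: "cs = a @ b" "length a = length us" "length b = length vs"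
      using cs(1) by (auto simp: a_def b_def)
    have lin: "F * lincomb a us + lincomb b vs \<in> B"
      using cs(2) ab by (simp add: lincomb_append lincomb_map_mult)
    \<comment> \<open>Modulo C the multiple of F disappears, so independence of \<open>vs\<close>
      can be used before that of \<open>us\<close>.\<close>
    have "lincomb b vs = (F * lincomb a us + lincomb b vs) + F * (- lincomb a us)" by simp
    then have "lincomb b vs \<in> C" unfolding memC using lin uc[of a] by (meson mpol_ring_uminus_closed)
    then have b: "set b \<subseteq> {0}" using vs ab(3) by (auto simp: basis_mod_def independent_mod_def)
    then have "F * lincomb a us \<in> B" using lin by (simp add: lincomb_zero)
    then have "lincomb a us \<in> A" using colon uc by blast
    then have "set a \<subseteq> {0}"
      using us ab(2) by (cases "d \<le> e") (auto simp: basis_mod_def independent_mod_def)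
    then show "set cs \<subseteq> {0}" using b ab(1) by simp
  qed
  moreover have "\<exists>cs. length cs = length (map ((*) F) us @ vs) \<and> p - lincomb cs (map ((*) F) us @ vs) \<in> B"
    if p: "p \<in> forms n e" for p
  proof -
    obtain b where b: "length b = length vs" "p - lincomb b vs \<in> C"
      using vs p by (auto simp: basis_mod_def)
    then obtain x r where xr: "x \<in> B" "r \<in> carrier (mpol_ring n)" "p - lincomb b vs = x + F * r"
      unfolding memC by blast
    \<comment> \<open>The left side is a form of degree e, so \<open>x\<close> and \<open>r\<close>
      may be replaced by their parts of the matching degrees.\<close>
    have "p - lincomb b vs = homog_part e (x + F * r)"
      using homog_part_form[OF forms_closed(5)[OF p lincomb_mem_forms[OF vs_forms, of b]], of e] unfolding xr(3) by simp
    also have "\<dots> = homog_part e x + homog_part e (F * r)" by (rule homog_part_add)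
    finally have eq: "p - lincomb b vs = homog_part e x + homog_part e (F * r)" .
    have x: "homog_part e x \<in> B" using B(2) xr(1) by (simp add: homogeneous_def)
    have "\<exists>a. length a = length us \<and> homog_part e (F * r) - F * lincomb a us \<in> B"
    proof (cases "d \<le> e")
      case True
      have h: "homog_part (e - d) r \<in> forms n (e - d)" using xr(2) by (rule homog_part_mem_forms)
      then obtain a where a: "length a = length us" "homog_part (e - d) r - lincomb a us \<in> A"
        using us(1)[OF True] by (auto simp: basis_mod_def)
      then have "F * (homog_part (e - d) r - lincomb a us) \<in> B"
        using colon mpol_ideal_closed(6)[OF A] by blast
      then show ?thesis
        using a(1) True by (auto simp: homog_part_mult_form[OF F xr(2)] algebra_simps)
    next
      case False
      then show ?thesis
        using us(2) mpol_ideal_closed(1)[OF B(1)] by (simp add: homog_part_mult_form[OF F xr(2)])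
    qed
    then obtain a where a: "length a = length us" "homog_part e (F * r) - F * lincomb a us \<in> B" by blast
    have "p - lincomb (a @ b) (map ((*) F) us @ vs) = homog_part e x + (homog_part e (F * r) - F * lincomb a us)"
      using eq a(1) by (simp add: lincomb_append lincomb_map_mult algebra_simps)
    also have "\<dots> \<in> B" by (rule mpol_ideal_closed(2)[OF B(1) x a(2)])
    finally show ?thesis using a(1) b(1) by (intro exI[of _ "a @ b"]) simp
  qed
  ultimately show ?thesis using vs_forms by (simp add: basis_mod_def)
qed

text \<open>Counts the basis elements in the exact sequence given by multiplication by F.\<close>

lemma hilbert_function_add_PIdl:
  fixes A B C :: "'k::field mpol set"
  assumes A: "ideal A (mpol_ring n)" "A \<noteq> carrier (mpol_ring n)"
    and B: "ideal B (mpol_ring n)" "homogeneous B" and F: "F \<in> forms n d"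
    and colon: "\<And>x. x \<in> carrier (mpol_ring n) \<Longrightarrow> F * x \<in> B \<longleftrightarrow> x \<in> A"
    and C: "C = B <+>\<^bsub>mpol_ring n\<^esub> PIdl\<^bsub>mpol_ring n\<^esub> F" "C \<noteq> carrier (mpol_ring n)"
  shows "hilbert_function n B i = hilbert_function n A (i - int d) + hilbert_function n C i"
proof (cases "i < 0")
  case False
  then obtain e where e: "i = int e" by (metis nonneg_int_cases not_less)
  interpret R: cring "mpol_ring n :: 'k mpol ring" by (rule mpol_ring_cring)
  have Fc: "F \<in> carrier (mpol_ring n)" using F by (rule formsD)
  have Ci: "ideal C (mpol_ring n)" "B \<subseteq> C" unfolding C(1) by (intro R.ideal_add_PIdl B(1) Fc)+
  \<comment> \<open>Properness passes from C down to B.\<close>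
  have Bp: "B \<noteq> carrier (mpol_ring n)" using Ci C(2) mpol_ideal_closed(6)[OF Ci(1)] by blast
  obtain vs where vs: "basis_mod n C e vs" using basis_mod_exists[OF Ci(1) C(2)] by blast
  \<comment> \<open>The empty list for e < d matches the value 0 of the Hilbert function at negative
    arguments.\<close>
  define us where "us = (if d \<le> e then SOME us. basis_mod n A (e - d) us else [])"
  have us: "basis_mod n A (e - d) us" if "d \<le> e"
    unfolding us_def using someI_ex[OF basis_mod_exists[OF A, of "e - d"]] that by simp
  have "basis_mod n B e (map ((*) F) us @ vs)"
    by (rule basis_mod_append[OF A(1) B F colon C(1) us _ vs]) (simp_all add: us_def)
  then have "hilbert_function n B i = length us + length vs"
    unfolding e using hilbert_function_eq_length[OF B(1) Bp] by simp
  moreover have "hilbert_function n C i = length vs"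
    unfolding e by (rule hilbert_function_eq_length[OF Ci(1) C(2) vs])
  moreover have "hilbert_function n A (i - int d) = length us"
  proof (cases "d \<le> e")
    case True
    then show ?thesis
      using hilbert_function_eq_length[OF A us[OF True]] by (simp add: e of_nat_diff)
  qed (simp add: e us_def hilbert_function_def)
  ultimately show ?thesis by simp
qed (simp add: hilbert_function_def)

section \<open>Exponents\<close>

lemma finite_exponents: "finite (exponents r s)"
proof -
  have "exponents r s \<subseteq> {as. set as \<subseteq> {..s} \<and> length as = r}"
    by (auto simp: exponents_def dest: member_le_sum_list)
  then show ?thesis by (rule finite_subset) (simp add: finite_lists_length_eq)
qed

lemma exponents_1: "exponents r (Suc 0) = {replicate r 0}"
  by (auto simp: exponents_def sum_list_eq_0_iff intro!: replicate_eqI)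

text \<open>Case distinction on the last entry: if it is 0, it is dropped; if it is positive,
  lowering it by one lowers the bound by one. For s = 0 the second set is empty, because the bound
  is then -1.\<close>

lemma exponents_Suc_Suc:
  "exponents (Suc r) (Suc s) =
     (\<lambda>as. as @ [0]) ` exponents r (Suc s) \<union> (\<lambda>as. butlast as @ [Suc (last as)]) ` exponents (Suc r) s"
proof (intro Set.set_eqI iffI)
  fix as assume as: "as \<in> exponents (Suc r) (Suc s)"
  then obtain bs k where bs: "as = bs @ [k]" by (cases as rule: rev_cases) (auto simp: exponents_def)
  show "as \<in> (\<lambda>as. as @ [0]) ` exponents r (Suc s) \<union> (\<lambda>as. butlast as @ [Suc (last as)]) ` exponents (Suc r) s"
  proof (cases k)
    case 0
    then show ?thesis using as bs by (intro UnI1 image_eqI[of _ _ bs]) (auto simp: exponents_def)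
  next
    case (Suc m)
    then show ?thesis using as bs by (intro UnI2 image_eqI[of _ _ "bs @ [m]"]) (auto simp: exponents_def)
  qed
next
  fix as assume "as \<in> (\<lambda>as. as @ [0]) ` exponents r (Suc s) \<union> (\<lambda>as. butlast as @ [Suc (last as)]) ` exponents (Suc r) s"
  then show "as \<in> exponents (Suc r) (Suc s)"
  proof
    assume "as \<in> (\<lambda>as. butlast as @ [Suc (last as)]) ` exponents (Suc r) s"
    then obtain bs where bs: "bs \<in> exponents (Suc r) s" "as = butlast bs @ [Suc (last bs)]" by blast
    then obtain cs k where "bs = cs @ [k]" by (cases bs rule: rev_cases) (auto simp: exponents_def)
    then show ?thesis using bs by (auto simp: exponents_def)
  qed (auto simp: exponents_def)
qed

text \<open>Raising the last entry by one raises the weighted sum by d, which appears as the shift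
  of the argument of \<open>h\<close>.\<close>

lemma sum_exponents_Suc_Suc:
  fixes h :: "int \<Rightarrow> nat"
  assumes "length ds = r"
  shows "(\<Sum>as \<in> exponents (Suc r) (Suc s). h (i - (\<Sum>j < Suc r. int (as ! j) * int ((ds @ [d]) ! j)))) =
    (\<Sum>as \<in> exponents (Suc r) s. h (i - int d - (\<Sum>j < Suc r. int (as ! j) * int ((ds @ [d]) ! j)))) +
    (\<Sum>as \<in> exponents r (Suc s). h (i - (\<Sum>j < r. int (as ! j) * int (ds ! j))))"
proof -
  let ?w = "\<lambda>as. \<Sum>j < Suc r. int (as ! j) * int ((ds @ [d]) ! j)"
  let ?f = "\<lambda>as. as @ [0] :: nat list" and ?g = "\<lambda>as. butlast as @ [Suc (last as)]"
  have w: "?w (bs @ [k]) = (\<Sum>j < r. int (bs ! j) * int (ds ! j)) + int k * int d" if "length bs = r" for bs k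
    using that assms by (simp add: nth_append)
  have g: "?w (?g as) = ?w as + int d" if as: "as \<in> exponents (Suc r) s" for as
  proof -
    obtain bs k where bs: "as = bs @ [k]" using as by (cases as rule: rev_cases) (auto simp: exponents_def)
    then have "length bs = r" using as by (simp add: exponents_def)
    then show ?thesis using w[of bs k] w[of bs "Suc k"] unfolding bs by (simp add: algebra_simps)
  qed
  have inj: "inj_on ?g (exponents (Suc r) s)"
  proof (rule inj_onI)
    fix as bs assume "as \<in> exponents (Suc r) s" "bs \<in> exponents (Suc r) s" "?g as = ?g bs"
    moreover from this have "as \<noteq> []" "bs \<noteq> []" by (auto simp: exponents_def)
    ultimately show "as = bs" by (metis append_butlast_last_id append1_eq_conv nat.inject)
  qed
  have "(\<Sum>as \<in> exponents (Suc r) (Suc s). h (i - ?w as)) =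
      (\<Sum>as \<in> ?f ` exponents r (Suc s). h (i - ?w as)) + (\<Sum>as \<in> ?g ` exponents (Suc r) s. h (i - ?w as))"
    unfolding exponents_Suc_Suc by (intro sum.union_disjoint finite_imageI finite_exponents) auto
  also have "(\<Sum>as \<in> ?f ` exponents r (Suc s). h (i - ?w as)) =
      (\<Sum>as \<in> exponents r (Suc s). h (i - ?w (?f as)))"
    by (subst sum.reindex) (auto simp: inj_on_def)
  also have "\<dots> = (\<Sum>as \<in> exponents r (Suc s). h (i - (\<Sum>j < r. int (as ! j) * int (ds ! j))))"
    by (intro sum.cong refl, subst w) (auto simp: exponents_def)
  also have "(\<Sum>as \<in> ?g ` exponents (Suc r) s. h (i - ?w as)) = (\<Sum>as \<in> exponents (Suc r) s. h (i - ?w (?g as)))"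
    by (subst sum.reindex[OF inj]) simp
  also have "\<dots> = (\<Sum>as \<in> exponents (Suc r) s. h (i - int d - ?w as))"
    by (intro sum.cong refl) (simp only: g, simp add: algebra_simps)
  finally show ?thesis by simp
qed

section \<open>Powers of a complete intersection\<close>

lemma (in cring) regular_sequence_snocD:
  assumes "regular_sequence R (Fs @ [F])"
  shows "regular_sequence R Fs" "nzd_mod R (Idl (set Fs)) F"
proof -
  have sub: "set Fs \<subseteq> carrier R" "F \<in> carrier R" using assms(1) by (auto simp: regular_sequence_def)
  have nzd: "nonzerodivisor (R Quot Idl (set (take j (Fs @ [F])))) (Idl (set (take j (Fs @ [F]))) +> (Fs @ [F]) ! j)"
    if "j < Suc (length Fs)" for j
    using assms(1) that by (auto simp: regular_sequence_def)
  have last: "nonzerodivisor (R Quot Idl (set Fs)) (Idl (set Fs) +> F)"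
    using nzd[of "length Fs"] by simp
  have init: "nonzerodivisor (R Quot Idl (set (take j Fs))) (Idl (set (take j Fs)) +> Fs ! j)"
    if "j < length Fs" for j
    using nzd[of j] that by (simp add: nth_append)
  show "nzd_mod R (Idl (set Fs)) F"
    using genideal_ideal[OF sub(1)] sub(2) last by (rule nonzerodivisor_Quot)
  have "ideal (Idl (set (Fs @ [F]))) R" using sub by (intro genideal_ideal) auto
  \<comment> \<open>The ideal of the initial segment is contained in the ideal of the full sequence,
    so it is proper too.\<close>
  then have "Idl (set (Fs @ [F])) = carrier R" if "Idl (set Fs) = carrier R"
    using subset_Idl_subset[of "set (Fs @ [F])" "set Fs"] sub that ideal.Icarr by fastforce
  then show "regular_sequence R Fs"
    using assms(1) sub init unfolding regular_sequence_def by blast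
qed

text \<open>The three claims are proved together by adding forms at the end: the recursions for the
  longer sequence use regularity modulo powers of J and homogeneity of those powers.\<close>

lemma hilbert_function_pow:
  fixes Fs :: "'k::field mpol list"
  assumes "length ds = length Fs" "\<And>j. j < length Fs \<Longrightarrow> Fs ! j \<in> forms n (ds ! j)"
    and "regular_sequence (mpol_ring n) Fs"
  defines "J \<equiv> Idl\<^bsub>mpol_ring n\<^esub> (set Fs)"
  shows "cring.nzd_lifts (mpol_ring n) J"
    and "homogeneous (J \<up>\<^bsub>mpol_ring n\<^esub> Suc s)"
    and "hilbert_function n (J \<up>\<^bsub>mpol_ring n\<^esub> Suc s) i =
      (\<Sum>as \<in> exponents (length Fs) (Suc s).
         hilbert_function n J (i - (\<Sum>j < length Fs. int (as ! j) * int (ds ! j))))"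
proof -
  interpret R: cring "mpol_ring n :: 'k mpol ring" by (rule mpol_ring_cring)
  have "R.nzd_lifts J \<and> (\<forall>s. homogeneous (J \<up>\<^bsub>mpol_ring n\<^esub> Suc s)) \<and>
    (\<forall>s i. hilbert_function n (J \<up>\<^bsub>mpol_ring n\<^esub> Suc s) i =
      (\<Sum>as \<in> exponents (length Fs) (Suc s).
         hilbert_function n J (i - (\<Sum>j < length Fs. int (as ! j) * int (ds ! j)))))"
    using assms(1-3) unfolding J_def
  proof (induction Fs arbitrary: ds rule: rev_induct)
    case Nil
    have J: "Idl\<^bsub>mpol_ring n\<^esub> (set []) = {0 :: 'k mpol}"
      using R.genideal_minimal[OF R.zeroideal, of "{}"] mpol_ideal_closed(1)[OF R.genideal_ideal[of "{}"]] by auto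
    have pow: "{0 :: 'k mpol} \<up>\<^bsub>mpol_ring n\<^esub> Suc s = {0}" for s using R.zero_pow_Suc by simp
    have "exponents 0 (Suc s) = {[]}" for s by (auto simp: exponents_def)
    then show ?case
      unfolding J pow using R.nzd_lifts_zero by (simp add: homogeneous_def)
  next
    case (snoc F Fs)
    define J where "J = Idl\<^bsub>mpol_ring n\<^esub> (set Fs)"
    define I where "I = J <+>\<^bsub>mpol_ring n\<^esub> PIdl\<^bsub>mpol_ring n\<^esub> F"
    obtain es d where ds: "ds = es @ [d]" "length es = length Fs"
      using snoc.prems(1) by (cases ds rule: rev_cases) auto
    have F: "F \<in> forms n d" using snoc.prems(2)[of "length Fs"] ds by (simp add: nth_append)
    have Fs: "Fs ! j \<in> forms n (es ! j)" if "j < length Fs" for j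
      using snoc.prems(2)[of j] that ds by (simp add: nth_append)
    note reg = R.regular_sequence_snocD[OF snoc.prems(3), folded J_def]
    have lifts: "R.nzd_lifts J" and hom: "homogeneous (J \<up>\<^bsub>mpol_ring n\<^esub> Suc s)"
      and hilb: "hilbert_function n (J \<up>\<^bsub>mpol_ring n\<^esub> Suc s) i = (\<Sum>as \<in> exponents (length Fs) (Suc s).
         hilbert_function n J (i - (\<Sum>j < length Fs. int (as ! j) * int (es ! j))))" for s i
      using snoc.IH[OF ds(2) Fs reg(1)] by (auto simp: J_def)
    have Fc: "F \<in> carrier (mpol_ring n)" using F by (rule formsD)
    have Fs_sub: "set Fs \<subseteq> carrier (mpol_ring n)" using reg(1) by (simp add: regular_sequence_def)
    have J: "ideal J (mpol_ring n)" unfolding J_def by (rule R.genideal_ideal[OF Fs_sub])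
    note I = R.ideal_add_PIdl[OF J Fc, folded I_def]
    have I_eq: "Idl\<^bsub>mpol_ring n\<^esub> (set (Fs @ [F])) = I"
      using R.Idl_insert[OF Fs_sub Fc] by (simp add: I_def J_def)
    have I_proper: "I \<noteq> carrier (mpol_ring n)"
      using snoc.prems(3) unfolding regular_sequence_def I_eq by blast
    have proper: "K \<noteq> carrier (mpol_ring n)" if "K \<subseteq> I" for K
      using that I_proper mpol_ideal_closed(6)[OF I(1)] by blast
    have Jt: "ideal (J \<up>\<^bsub>mpol_ring n\<^esub> t) (mpol_ring n)" and It: "ideal (I \<up>\<^bsub>mpol_ring n\<^esub> t) (mpol_ring n)" for t
      using R.ideal_pow_ideal J I(1) by auto
    have Jt_sub: "J \<up>\<^bsub>mpol_ring n\<^esub> Suc t \<subseteq> I" and It_sub: "I \<up>\<^bsub>mpol_ring n\<^esub> Suc t \<subseteq> I" for t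
      using R.ideal_pow_Suc_subset(2)[OF J] R.ideal_pow_Suc_subset(2)[OF I(1)] I(2) by blast+
    \<comment> \<open>The index is shifted: \<open>C t\<close> uses the power t + 1, since the power
      0 would give the whole ring.\<close>
    define C where "C t = J \<up>\<^bsub>mpol_ring n\<^esub> Suc t <+>\<^bsub>mpol_ring n\<^esub> PIdl\<^bsub>mpol_ring n\<^esub> F" for t
    have C_sub: "C t \<subseteq> I" for t
    proof
      fix x assume "x \<in> C t"
      then obtain j r where "j \<in> J \<up>\<^bsub>mpol_ring n\<^esub> Suc t" "r \<in> carrier (mpol_ring n)" "x = j + F * r"
        unfolding C_def using R.mem_add_PIdl_iff[OF Jt Fc] by auto
      then show "x \<in> I"
        using R.ideal_pow_Suc_subset(2)[OF J] unfolding I_def using R.mem_add_PIdl_iff[OF J Fc] by auto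
    qed
    \<comment> \<open>The exact sequence with A = B = J^(t+1), as F is regular modulo this
      power.\<close>
    have J_step: "hilbert_function n (J \<up>\<^bsub>mpol_ring n\<^esub> Suc t) i =
        hilbert_function n (J \<up>\<^bsub>mpol_ring n\<^esub> Suc t) (i - int d) + hilbert_function n (C t) i" for t i
    proof (rule hilbert_function_add_PIdl[OF Jt _ Jt hom F _ C_def])
      fix x :: "'k mpol" assume x: "x \<in> carrier (mpol_ring n)"
      show "F * x \<in> J \<up>\<^bsub>mpol_ring n\<^esub> Suc t \<longleftrightarrow> x \<in> J \<up>\<^bsub>mpol_ring n\<^esub> Suc t"
        using nzd_modD[OF R.nzd_mod_pow[OF lifts J reg(2)] _ x] mpol_ideal_closed(5)[OF Jt Fc] by auto
    qed (intro proper Jt_sub C_sub)+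
    have I_hom: "homogeneous (I \<up>\<^bsub>mpol_ring n\<^esub> t)" for t
      unfolding I_def by (rule homogeneous_ideal_pow[OF J F hom])
    \<comment> \<open>The exact sequence with A = I^(t+1) and B = I^(t+2), by the colon formula. Its
      third ideal is determined by J and F, so it is again one of the \<open>C\<close>.\<close>
    have I_step: "hilbert_function n (I \<up>\<^bsub>mpol_ring n\<^esub> Suc (Suc t)) i =
        hilbert_function n (I \<up>\<^bsub>mpol_ring n\<^esub> Suc t) (i - int d) + hilbert_function n (C (Suc t)) i" for t i
    proof (rule hilbert_function_add_PIdl[OF It _ It I_hom F])
      fix x :: "'k mpol" assume x: "x \<in> carrier (mpol_ring n)"
      show "F * x \<in> I \<up>\<^bsub>mpol_ring n\<^esub> Suc (Suc t) \<longleftrightarrow> x \<in> I \<up>\<^bsub>mpol_ring n\<^esub> Suc t"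
        using R.colon_ideal_pow[OF lifts J reg(2) x, of "Suc t"] by (simp add: I_def)
    next
      show "C (Suc t) = I \<up>\<^bsub>mpol_ring n\<^esub> Suc (Suc t) <+>\<^bsub>mpol_ring n\<^esub> PIdl\<^bsub>mpol_ring n\<^esub> F"
        unfolding C_def I_def by (rule R.pow_Suc_add_PIdl[OF J Fc, symmetric])
    qed (intro proper It_sub C_sub)+
    have C0: "C 0 = I" unfolding C_def R.ideal_pow_1[OF J] I_def ..
    have hJ: "hilbert_function n J i = hilbert_function n J (i - int d) + hilbert_function n I i" for i
      using J_step[of 0] unfolding R.ideal_pow_1[OF J] C0 .
    have hC: "hilbert_function n (C t) i = (\<Sum>as \<in> exponents (length Fs) (Suc t).
        hilbert_function n I (i - (\<Sum>j < length Fs. int (as ! j) * int (es ! j))))" for t i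
    proof -
      let ?w = "\<lambda>as. \<Sum>j < length Fs. int (as ! j) * int (es ! j)"
      have "(\<Sum>as \<in> exponents (length Fs) (Suc t). hilbert_function n J (i - ?w as)) =
          (\<Sum>as \<in> exponents (length Fs) (Suc t). hilbert_function n J (i - int d - ?w as)) +
          (\<Sum>as \<in> exponents (length Fs) (Suc t). hilbert_function n I (i - ?w as))"
        unfolding sum.distrib[symmetric]
        by (intro sum.cong refl, subst hJ) (simp add: algebra_simps)
      \<comment> \<open>Both powers of J in \<open>J_step\<close> are expanded by the induction
        hypothesis; cancelling the sum shifted by d leaves the claim.\<close>
      then show ?thesis using J_step[of t i] unfolding hilb by simp
    qed
    have "hilbert_function n (I \<up>\<^bsub>mpol_ring n\<^esub> Suc t) i = (\<Sum>as \<in> exponents (Suc (length Fs)) (Suc t).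
        hilbert_function n I (i - (\<Sum>j < Suc (length Fs). int (as ! j) * int ((es @ [d]) ! j))))" for t i
    proof (induction t arbitrary: i)
      case 0
      then show ?case unfolding R.ideal_pow_1[OF I(1)] exponents_1 by (simp del: replicate_Suc)
    next
      case (Suc t)
      \<comment> \<open>The two summands of \<open>I_step\<close> are the sums over exponents with
        positive last entry and with last entry 0.\<close>
      show ?case
        unfolding sum_exponents_Suc_Suc[OF ds(2)] I_step Suc.IH hC ..
    qed
    moreover have "R.nzd_lifts I" unfolding I_def by (rule R.nzd_lifts_step[OF lifts J reg(2)])
    ultimately show ?case using I_hom unfolding I_eq ds(1) by simp
  qed
  then show "R.nzd_lifts J" "homogeneous (J \<up>\<^bsub>mpol_ring n\<^esub> Suc s)"
    "hilbert_function n (J \<up>\<^bsub>mpol_ring n\<^esub> Suc s) i = (\<Sum>as \<in> exponents (length Fs) (Suc s).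
         hilbert_function n J (i - (\<Sum>j < length Fs. int (as ! j) * int (ds ! j))))" by blast+
qed

theorem corollary2p3:
  fixes n s :: nat and ds :: "nat list"
    and Fs :: "'k::field_char_0 mpol list" and I :: "'k mpol set"
  assumes "complete_intersection n ds Fs"
    and "I = Idl\<^bsub>mpol_ring n\<^esub> (set Fs)"
    and "s \<ge> 1"
  shows "\<forall>i :: int.
    hilbert_function n (I [^]\<^bsub>ideals_set (mpol_ring n)\<^esub> s) i =
    (\<Sum>as \<in> exponents (length Fs) s.
       hilbert_function n I (i - (\<Sum>j < length Fs. int (as ! j) * int (ds ! j))))"
proof -
  obtain t where "s = Suc t" using assms(3) by (cases s) auto
  then show ?thesis
    using hilbert_function_pow(3)[of ds Fs n t] assms(1) unfolding complete_intersection_def assms(2) ideal_pow_def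
    by blast
qed

end
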